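(* Let $\Gamma$ be a totally ordered abelian group with small-extensions closure $\Gamma_{\mathrm{sme}}\subset\mathbb{R}^{\mathbb{I}}_{\mathrm{lex}}$. Let $\Gamma\hookrightarrow\Lambda$ be a small extension, let $\Gamma^{\mathrm{com}}\subset\Lambda$ be the subgroup of elements of $\Lambda$ commensurable over $\Gamma$, and let $\gamma\in\Lambda$ be such that $\Lambda=\langle\Gamma^{\mathrm{com}},\gamma\rangle$. Let $\Gamma^{\mathrm{com}}\xrightarrow{\sim}\Delta\subset\Gamma_{\mathbb{Q}}$ be the canonical embedding of $\Gamma^{\mathrm{com}}$ into $\Gamma_{\mathbb{Q}}$. Then, for a unique $\beta\in\Gamma_{\mathrm{sme}}$ there exists an isomorphism of ordered groups $$\Lambda\xrightarrow{\ \sim\ }\langle\Delta,\beta\rangle$$ (where $\langle\Delta,\beta\rangle$ is the subgroup of $\mathbb{R}^{\mathbb{I}}_{\mathrm{lex}}$ generated by $\Delta$ and $\beta$) sending $\gamma$ to $\beta$ and whose restriction to $\Gamma^{\mathrm{com}}$ is the canonical isomorphism $\Gamma^{\mathrm{com}}\xrightarrow{\sim}\Delta$.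
   Context: Ordered sets are totally ordered; ordered groups are totally ordered abelian groups; embeddings and extensions strictly preserve order. Small extensions. For an extension $\Gamma\hookrightarrow\Lambda$ of ordered groups, $\Gamma^{\mathrm{com}}=\{\xi\in\Lambda\mid n\xi\in\Gamma\text{ for some integer }n\ge1\}$. The extension is small if $\Lambda/\Gamma^{\mathrm{com}}$ is a cyclic group (possibly trivial). The canonical embedding $\Gamma^{\mathrm{com}}\hookrightarrow\Gamma_{\mathbb Q}$ is the unique embedding of ordered groups extending the identity of $\Gamma$. Setting. $\Gamma_{\mathbb Q}=\Gamma\otimes_{\mathbb Z}\mathbb Q$ is the divisible hull with its natural order. A subgroup $H$ of an ordered group is convex if $|\rho|\le|\gamma|$, $\gamma\in H$ imply $\rho\in H$; it is principal if it is the convex subgroup generated by one element. $I=\mathrm{Prin}(\Gamma)=\mathrm{Prin}(\Gamma_{\mathbb Q})$ is the set of non-zero principal convex subgroups (canonically the same for $\Gamma$ and $\Gamma_{\mathbb Q}$), ordered by decreasing inclusion. For $i\in I$, $H_i\subset\Gamma_{\mathbb Q}$ is the corresponding subgroup, $H_i^*$ is the largest convex subgroup properly contained in $H_i$, and $Q_i=H_i/H_i^*$ (of rank one). For an ordered set $J$ and ordered groups $G_j$, the Hahn product $(\prod_{j\in J}G_j)_{\mathrm{lex}}$ is the group of elements of $\prod_j G_j$ with well-ordered support, ordered lexicographically; it is written $G^J_{\mathrm{lex}}$ if all $G_j=G$ (and $\mathbb R^\emptyset_{\mathrm{lex}}=\{0\}$). Fix ordered-group embeddings $Q_i\hookrightarrow\mathbb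 R$, and fix (Hahn's embedding theorem) an immediate embedding of $\Gamma_{\mathbb Q}$ into $\mathbb H(\Gamma_{\mathbb Q})=(\prod_{i\in I}Q_i)_{\mathrm{lex}}$, i.e. an ordered-group embedding such that an element generating $H_i$ as a convex subgroup has image with zero coordinates at all $j<i$ and with $i$-th coordinate its class in $Q_i$. Identify $\Gamma\subset\Gamma_{\mathbb Q}\subset\mathbb H(\Gamma_{\mathbb Q})\subset\mathbb R^I_{\mathrm{lex}}$. $\mathrm{Init}(I)$ is the set of initial segments of $I$ (including $\emptyset$ and $I$), ordered by inclusion. $\mathbb I=I\sqcup\{i_S\mid S\in\mathrm{Init}(I)\}$ with the total order extending that of $I$ such that $S<i_S<I\setminus S$ for all $S$, and $i_S<i_T\Leftrightarrow S\subsetneq T$. $I_S=I\cup\{i_S\}\subset\mathbb I$. For $J\subset J'\subset \mathbb I$, regard $\mathbb R^J_{\mathrm{lex}}\subset\mathbb R^{J'}_{\mathrm{lex}}$ via extension by zero. For $\beta\in\mathbb R^I_{\mathrm{lex}}$ and $S\in\mathrm{Init}(I)$ let $\beta_S\in\mathbb R^S_{\mathrm{lex}}$ be the restriction of $\beta$ to $S$; for $\rho\in \mathbb R^S_{\mathrm{lex}}$ let $(\rho\mid0)$ be its extension by zero. An element $\rho\in\mathbb R^S_{\mathrm{lex}}$ is commensurable if $\rho=b_S$ for some $b\in\Gamma_{\mathbb Q}$, incommensurable otherwise. $\mathrm{EqRk}(\Gamma)$ is the set of minimal incommensurable elements: those $\beta\in\mathbb R^I_{\mathrm{lex}}$ for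 which there is a smallest $S\in\mathrm{Init}(I)$ with $\beta_S$ incommensurable, and $\beta=(\beta_S\mid0)$ for this $S$. $\mathrm{IncRk}(\Gamma)$ is the set of all elements $b^{\pm}=(b\mid\pm1\mid0)\in\mathbb R^{I_S}_{\mathrm{lex}}$, with $S\in\mathrm{Init}(I)$ and $b\in\mathbb R^S_{\mathrm{lex}}$ commensurable, whose restriction to $S$ is $b$, whose $i_S$-coordinate is $\pm1$, and whose other coordinates are $0$. Finally $\Gamma_{\mathbb R}=\Gamma_{\mathbb Q}\sqcup\mathrm{EqRk}(\Gamma)$ and $\Gamma_{\mathrm{sme}}=\Gamma_{\mathbb R}\sqcup\mathrm{IncRk}(\Gamma)\subset\mathbb R^{\mathbb I}_{\mathrm{lex}}$, with the induced order. *)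

theory Defs
  imports Complex_Main "HOL-Library.Function_Algebras" "HOL-Algebra.Elementary_Groups"
begin

definition add_grp :: "'a::ab_group_add set \<Rightarrow> 'a monoid"
  where "add_grp A = \<lparr>carrier = A, mult = (+), one = 0\<rparr>"

definition nsmul :: "nat \<Rightarrow> 'a::ab_group_add \<Rightarrow> 'a"
  where "nsmul n x = (\<Sum>_<n. x)"

lemma nsmul_add: "nsmul n (x + y) = nsmul n x + nsmul n y"
  by (simp add: nsmul_def sum.distrib)

lemma nsmul_uminus: "nsmul n (- x) = - nsmul n x"
  by (simp add: nsmul_def sum_negf)

lemma nsmul_0_right [simp]: "nsmul n 0 = 0"
  by (simp add: nsmul_def)

lemma nsmul_1 [simp]: "nsmul (Suc 0) x = x"
  by (simp add: nsmul_def)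

lemma nsmul_Suc: "nsmul (Suc n) x = x + nsmul n x"
  by (simp add: nsmul_def add.commute)

lemma nsmul_add_left: "nsmul (m + n) x = nsmul m x + nsmul n x"
proof (induction m)
  case 0
  show ?case by (simp add: nsmul_def)
qed (simp add: nsmul_Suc add.assoc)

lemma nsmul_mult: "nsmul m (nsmul n x) = nsmul (m * n) x"
proof (induction m)
  case 0
  show ?case by (simp add: nsmul_def)
qed (simp add: nsmul_Suc nsmul_add_left)

lemma nsmul_comm: "nsmul m (nsmul n x) = nsmul n (nsmul m x)"
  by (simp add: nsmul_mult mult.commute)

lemma nsmul_less_iff [simp]:
  fixes x y :: "'a::linordered_ab_group_add"
  assumes "n > 0"
  shows "nsmul n x < nsmul n y \<longleftrightarrow> x < y"
proof -
  have less: "nsmul n a < nsmul n b" if "a < b" for a b :: 'a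
    unfolding nsmul_def using assms that by (intro sum_strict_mono) auto
  show ?thesis
    using less[of x y] less[of y x] by (cases x y rule: linorder_cases) auto
qed

lemma nsmul_le_iff [simp]:
  fixes x y :: "'a::linordered_ab_group_add"
  assumes "n > 0"
  shows "nsmul n x \<le> nsmul n y \<longleftrightarrow> x \<le> y"
  using nsmul_less_iff[OF assms, of y x] by (simp add: linorder_not_less[symmetric])

lemma nsmul_eq_iff [simp]:
  fixes x y :: "'a::linordered_ab_group_add"
  assumes "n > 0"
  shows "nsmul n x = nsmul n y \<longleftrightarrow> x = y"
  using nsmul_le_iff[OF assms, of y x] nsmul_le_iff[OF assms, of x y]
  by (metis order.antisym order.refl)

text \<open>The pair \<open>(a, m)\<close> with \<open>m > 0\<close> represents the fraction \<open>a / m\<close>, i.e. \<open>a \<otimes> (1 / m)\<close>;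
  every element of the tensor product with the rationals has this form.\<close>

definition frac_rel :: "'a::linordered_ab_group_add \<times> nat \<Rightarrow> 'a \<times> nat \<Rightarrow> bool"
  where "frac_rel p q \<longleftrightarrow> snd p > 0 \<and> snd q > 0 \<and> nsmul (snd q) (fst p) = nsmul (snd p) (fst q)"

lemma frac_rel_trans:
  assumes "frac_rel p q" "frac_rel q r"
  shows "frac_rel p r"
proof -
  have "nsmul (snd q) (nsmul (snd r) (fst p)) = nsmul (snd r) (nsmul (snd p) (fst q))"
    using assms(1) by (metis frac_rel_def nsmul_comm)
  also have "\<dots> = nsmul (snd q) (nsmul (snd p) (fst r))"
    using assms(2) by (metis frac_rel_def nsmul_comm)
  finally show ?thesis
    using assms by (simp add: frac_rel_def)
qed

quotient_type (overloaded) 'a dhull = "'a::linordered_ab_group_add \<times> nat" / partial: frac_rel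
proof (rule part_equivpI)
  show "\<exists>x::'a \<times> nat. frac_rel x x"
    by (rule exI[of _ "(0, 1)"]) (simp add: frac_rel_def)
  show "symp (frac_rel :: 'a \<times> nat \<Rightarrow> _)"
    by (rule sympI) (simp add: frac_rel_def)
  show "transp (frac_rel :: 'a \<times> nat \<Rightarrow> _)"
    by (rule transpI) (rule frac_rel_trans)
qed

lemma frac_le_respects:
  assumes "frac_rel p p'" "frac_rel q q'"
  shows "nsmul (snd q) (fst p) \<le> nsmul (snd p) (fst q) \<longleftrightarrow>
         nsmul (snd q') (fst p') \<le> nsmul (snd p') (fst q')"
proof -
  obtain a m b n a' m' b' n' where eqs: "p = (a, m)" "q = (b, n)" "p' = (a', m')" "q' = (b', n')"
    by (metis surj_pair)
  have pos: "m > 0" "n > 0" "m' > 0" "n' > 0"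
    and rel: "nsmul m' a = nsmul m a'" "nsmul n' b = nsmul n b'"
    using assms by (auto simp: frac_rel_def eqs)
  have 1: "nsmul (m' * n') (nsmul n a) = nsmul (m * n) (nsmul n' a')"
    using arg_cong[OF rel(1), of "nsmul (n * n')"] by (simp add: nsmul_mult mult_ac)
  have 2: "nsmul (m' * n') (nsmul m b) = nsmul (m * n) (nsmul m' b')"
    using arg_cong[OF rel(2), of "nsmul (m * m')"] by (simp add: nsmul_mult mult_ac)
  have "nsmul n a \<le> nsmul m b \<longleftrightarrow> nsmul (m' * n') (nsmul n a) \<le> nsmul (m' * n') (nsmul m b)"
    using pos by simp
  also have "\<dots> \<longleftrightarrow> nsmul n' a' \<le> nsmul m' b'"
    unfolding 1 2 using pos by simp
  finally show ?thesis
    by (simp add: eqs)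
qed

instantiation dhull :: (linordered_ab_group_add) linordered_ab_group_add
begin

lift_definition zero_dhull :: "'a dhull" is "(0, 1)"
  by (simp add: frac_rel_def)

lift_definition plus_dhull :: "'a dhull \<Rightarrow> 'a dhull \<Rightarrow> 'a dhull"
  is "\<lambda>p q. (nsmul (snd q) (fst p) + nsmul (snd p) (fst q), snd p * snd q)"
proof -
  fix p p' q q' :: "'a \<times> nat"
  assume *: "frac_rel p p'" "frac_rel q q'"
  have "nsmul (snd p' * snd q') (nsmul (snd q) (fst p)) = nsmul (snd q * snd q') (nsmul (snd p') (fst p))"
    by (simp add: nsmul_mult mult_ac)
  also have "\<dots> = nsmul (snd p * snd q) (nsmul (snd q') (fst p'))"
    using *(1) by (simp add: frac_rel_def) (simp add: nsmul_mult mult_ac)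
  finally have "nsmul (snd p' * snd q') (nsmul (snd q) (fst p)) = \<dots>" .
  moreover have "nsmul (snd p' * snd q') (nsmul (snd p) (fst q)) = nsmul (snd p * snd p') (nsmul (snd q') (fst q))"
    by (simp add: nsmul_mult mult_ac)
  then have "nsmul (snd p' * snd q') (nsmul (snd p) (fst q)) = nsmul (snd p * snd q) (nsmul (snd p') (fst q'))"
    using *(2) by (simp add: frac_rel_def) (simp add: nsmul_mult mult_ac)
  ultimately show "frac_rel (nsmul (snd q) (fst p) + nsmul (snd p) (fst q), snd p * snd q)
     (nsmul (snd q') (fst p') + nsmul (snd p') (fst q'), snd p' * snd q')"
    using * by (simp add: frac_rel_def nsmul_add)
qed

lift_definition uminus_dhull :: "'a dhull \<Rightarrow> 'a dhull" is "\<lambda>p. (- fst p, snd p)"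
  by (simp add: frac_rel_def nsmul_uminus)

definition minus_dhull :: "'a dhull \<Rightarrow> 'a dhull \<Rightarrow> 'a dhull"
  where "minus_dhull x y = x + - y"

lift_definition less_eq_dhull :: "'a dhull \<Rightarrow> 'a dhull \<Rightarrow> bool"
  is "\<lambda>p q. nsmul (snd q) (fst p) \<le> nsmul (snd p) (fst q)"
  by (rule frac_le_respects)

definition less_dhull :: "'a dhull \<Rightarrow> 'a dhull \<Rightarrow> bool"
  where "less_dhull x y \<longleftrightarrow> x \<le> y \<and> \<not> y \<le> x"

instance
proof
  fix x y z :: "'a dhull"
  show "x + y + z = x + (y + z)"
    by transfer (auto simp: frac_rel_def nsmul_add nsmul_mult mult_ac add_ac)
  show "x + y = y + x"
    by transfer (auto simp: frac_rel_def add_ac mult_ac)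
  show "0 + x = x"
    by transfer (auto simp: frac_rel_def nsmul_mult)
  show "- x + x = 0"
    by transfer (auto simp: frac_rel_def nsmul_uminus)
  show "x - y = x + - y"
    by (simp add: minus_dhull_def)
  show "x < y \<longleftrightarrow> x \<le> y \<and> \<not> y \<le> x"
    by (simp add: less_dhull_def)
  show "x \<le> x"
    by transfer simp
  show "x \<le> y \<or> y \<le> x"
    by transfer auto
  show "x = y" if "x \<le> y" "y \<le> x"
    using that by transfer (auto simp: frac_rel_def)
  show "x \<le> z" if "x \<le> y" "y \<le> z"
    using that
  proof transfer
    fix p q r :: "'a \<times> nat"
    assume pos: "frac_rel p p" "frac_rel q q" "frac_rel r r"
      and le: "nsmul (snd q) (fst p) \<le> nsmul (snd p) (fst q)"
              "nsmul (snd r) (fst q) \<le> nsmul (snd q) (fst r)"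
    have "nsmul (snd q) (nsmul (snd r) (fst p)) \<le> nsmul (snd r) (nsmul (snd p) (fst q))"
      using le(1) pos by (subst nsmul_comm) (simp add: frac_rel_def)
    also have "\<dots> \<le> nsmul (snd q) (nsmul (snd p) (fst r))"
      using le(2) pos by (subst nsmul_comm, subst (2) nsmul_comm) (simp add: frac_rel_def)
    finally show "nsmul (snd r) (fst p) \<le> nsmul (snd p) (fst r)"
      using pos by (simp add: frac_rel_def)
  qed
  show "z + x \<le> z + y" if "x \<le> y"
    using that
  proof transfer
    fix p q r :: "'a \<times> nat"
    assume pos: "frac_rel p p" "frac_rel q q" "frac_rel r r"
      and le: "nsmul (snd q) (fst p) \<le> nsmul (snd p) (fst q)"
    have "nsmul (snd r * snd r) (nsmul (snd q) (fst p)) \<le> nsmul (snd r * snd r) (nsmul (snd p) (fst q))"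
      using le pos by (simp add: frac_rel_def)
    then show "nsmul (snd (nsmul (snd q) (fst r) + nsmul (snd r) (fst q), snd r * snd q))
         (fst (nsmul (snd p) (fst r) + nsmul (snd r) (fst p), snd r * snd p))
        \<le> nsmul (snd (nsmul (snd p) (fst r) + nsmul (snd r) (fst p), snd r * snd p))
         (fst (nsmul (snd q) (fst r) + nsmul (snd r) (fst q), snd r * snd q))"
      by (simp add: nsmul_add nsmul_mult mult_ac)
  qed
qed

end

lift_definition to_dhull :: "'a::linordered_ab_group_add \<Rightarrow> 'a dhull" is "\<lambda>a. (a, 1)"
  by (simp add: frac_rel_def)

definition com :: "('g::linordered_ab_group_add \<Rightarrow> 'l::linordered_ab_group_add) \<Rightarrow> 'l set"
  where "com \<iota> = {\<xi>. \<exists>n\<ge>1. nsmul n \<xi> \<in> range \<iota>}"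

definition small_extension :: "('g::linordered_ab_group_add \<Rightarrow> 'l::linordered_ab_group_add) \<Rightarrow> bool"
  where "small_extension \<iota> \<longleftrightarrow>
    \<iota> \<in> hom (add_grp UNIV) (add_grp UNIV) \<and> strict_mono \<iota> \<and>
    cyclic_group (add_grp UNIV Mod com \<iota>)"

definition convex_subgroup :: "'a::linordered_ab_group_add set \<Rightarrow> bool"
  where "convex_subgroup H \<longleftrightarrow> subgroup H (add_grp UNIV) \<and>
    (\<forall>\<rho> \<gamma>. max \<rho> (- \<rho>) \<le> max \<gamma> (- \<gamma>) \<and> \<gamma> \<in> H \<longrightarrow> \<rho> \<in> H)"

definition Prin :: "'a::linordered_ab_group_add set set"
  where "Prin = {H. \<exists>x. H = convex_subgroup hull {x}} - {{0}}"

text \<open>An index \<open>i \<in> Prin\<close> is the subgroup \<open>H\<^sub>i\<close> itself, and \<open>i\<close> comes strictly before \<open>j\<close>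
  iff \<open>H\<^sub>j \<subset> H\<^sub>i\<close>.\<close>

definition prin_less :: "'a set \<Rightarrow> 'a set \<Rightarrow> bool"
  where "prin_less i j \<longleftrightarrow> j \<subset> i"

definition star :: "'a::linordered_ab_group_add set \<Rightarrow> 'a set"
  where "star H = (GREATEST K. convex_subgroup K \<and> K \<subset> H)"

text \<open>The elements of \<open>Quot i\<close> are cosets; its neutral element is \<open>star i\<close>.\<close>

definition Quot :: "'a::linordered_ab_group_add set \<Rightarrow> 'a set monoid"
  where "Quot i = add_grp i Mod star i"

definition coset_less :: "'a::linordered_ab_group_add set \<Rightarrow> 'a set \<Rightarrow> bool"
  where "coset_less A B \<longleftrightarrow> (\<forall>a\<in>A. \<forall>b\<in>B. a < b)"

text \<open>The index set \<open>J\<close> is totally ordered by the strict relation \<open>lt\<close>. Elements are extended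
  by the neutral elements outside \<open>J\<close>, so that extension by zero is inclusion.\<close>

definition hahn_product ::
    "'j set \<Rightarrow> ('j \<Rightarrow> 'j \<Rightarrow> bool) \<Rightarrow> ('j \<Rightarrow> 'a monoid) \<Rightarrow> ('j \<Rightarrow> 'a) set"
  where "hahn_product J lt G = {f. (\<forall>j\<in>J. f j \<in> carrier (G j)) \<and> (\<forall>j. j \<notin> J \<longrightarrow> f j = \<one>\<^bsub>G j\<^esub>) \<and>
    wfp_on {j \<in> J. f j \<noteq> \<one>\<^bsub>G j\<^esub>} lt}"

definition lex_less ::
    "'j set \<Rightarrow> ('j \<Rightarrow> 'j \<Rightarrow> bool) \<Rightarrow> ('a \<Rightarrow> 'a \<Rightarrow> bool) \<Rightarrow> ('j \<Rightarrow> 'a) \<Rightarrow> ('j \<Rightarrow> 'a) \<Rightarrow> bool"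
  where "lex_less J lt lta f g \<longleftrightarrow> (\<exists>k\<in>J. lta (f k) (g k) \<and> (\<forall>j\<in>J. lt j k \<longrightarrow> f j = g j))"

definition real_hahn :: "'j set \<Rightarrow> ('j \<Rightarrow> 'j \<Rightarrow> bool) \<Rightarrow> ('j \<Rightarrow> real) set"
  where "real_hahn J lt = hahn_product J lt (\<lambda>_. add_grp UNIV)"

definition quot_embeddings :: "('q::linordered_ab_group_add set \<Rightarrow> 'q set \<Rightarrow> real) \<Rightarrow> bool"
  where "quot_embeddings e \<longleftrightarrow> (\<forall>i\<in>Prin. e i \<in> hom (Quot i) (add_grp UNIV) \<and>
    (\<forall>A\<in>carrier (Quot i). \<forall>B\<in>carrier (Quot i). coset_less A B \<longrightarrow> e i A < e i B))"

definition immediate_embedding :: "('q::linordered_ab_group_add \<Rightarrow> 'q set \<Rightarrow> 'q set) \<Rightarrow> bool"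
  where "immediate_embedding \<phi> \<longleftrightarrow>
    range \<phi> \<subseteq> hahn_product Prin prin_less Quot \<and>
    (\<forall>i\<in>Prin. (\<lambda>x. \<phi> x i) \<in> hom (add_grp UNIV) (Quot i)) \<and>
    (\<forall>x y. x < y \<longrightarrow> lex_less Prin prin_less coset_less (\<phi> x) (\<phi> y)) \<and>
    (\<forall>i\<in>Prin. \<forall>x. convex_subgroup hull {x} = i \<longrightarrow>
      (\<forall>j\<in>Prin. prin_less j i \<longrightarrow> \<phi> x j = \<one>\<^bsub>Quot j\<^esub>) \<and>
      \<phi> x i = star i #>\<^bsub>add_grp i\<^esub> x)"

definition hull_emb ::
    "('q::linordered_ab_group_add set \<Rightarrow> 'q set \<Rightarrow> real) \<Rightarrow> ('q \<Rightarrow> 'q set \<Rightarrow> 'q set) \<Rightarrow> 'q \<Rightarrow> 'q set \<Rightarrow> real"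
  where "hull_emb e \<phi> x = (\<lambda>i. if i \<in> Prin then e i (\<phi> x i) else 0)"

definition Init :: "'j set \<Rightarrow> ('j \<Rightarrow> 'j \<Rightarrow> bool) \<Rightarrow> 'j set set"
  where "Init J lt = {S. S \<subseteq> J \<and> (\<forall>i\<in>S. \<forall>j\<in>J. lt j i \<longrightarrow> j \<in> S)}"

datatype 'j cut_index = Pt 'j | Cut "'j set"

definition cut_indices :: "'j set \<Rightarrow> ('j \<Rightarrow> 'j \<Rightarrow> bool) \<Rightarrow> 'j cut_index set"
  where "cut_indices J lt = Pt ` J \<union> Cut ` Init J lt"

fun cut_less :: "('j \<Rightarrow> 'j \<Rightarrow> bool) \<Rightarrow> 'j cut_index \<Rightarrow> 'j cut_index \<Rightarrow> bool"
  where
    "cut_less lt (Pt i) (Pt j) \<longleftrightarrow> lt i j"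
  | "cut_less lt (Pt i) (Cut S) \<longleftrightarrow> i \<in> S"
  | "cut_less lt (Cut S) (Pt i) \<longleftrightarrow> i \<notin> S"
  | "cut_less lt (Cut S) (Cut T) \<longleftrightarrow> S \<subset> T"

abbreviation prin_cuts :: "'q::linordered_ab_group_add set cut_index set"
  where "prin_cuts \<equiv> cut_indices Prin prin_less"

definition sme_less ::
    "('q::linordered_ab_group_add set cut_index \<Rightarrow> real) \<Rightarrow> ('q set cut_index \<Rightarrow> real) \<Rightarrow> bool"
  where "sme_less = lex_less prin_cuts (cut_less prin_less) (<)"

fun zero_ext :: "('j \<Rightarrow> real) \<Rightarrow> 'j cut_index \<Rightarrow> real"
  where
    "zero_ext f (Pt i) = f i"
  | "zero_ext f (Cut S) = 0"

text \<open>Below, \<open>\<Phi>\<close> is the embedding of the divisible hull into the Hahn product of copies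
  of the reals over \<open>Prin\<close>. An element of the Hahn product over an initial segment \<open>S\<close> is
  identified with its extension by zero; in particular \<open>restr S \<beta>\<close> stands both for the
  restriction of \<open>\<beta>\<close> to \<open>S\<close> and for the extension by zero of that restriction.\<close>

definition restr :: "'j set \<Rightarrow> ('j \<Rightarrow> real) \<Rightarrow> 'j \<Rightarrow> real"
  where "restr S \<beta> = (\<lambda>i. if i \<in> S then \<beta> i else 0)"

definition commensurable ::
    "('q::linordered_ab_group_add \<Rightarrow> 'q set \<Rightarrow> real) \<Rightarrow> 'q set set \<Rightarrow> ('q set \<Rightarrow> real) \<Rightarrow> bool"
  where "commensurable \<Phi> S \<rho> \<longleftrightarrow> (\<exists>b. \<rho> = restr S (\<Phi> b))"

definition EqRk :: "('q::linordered_ab_group_add \<Rightarrow> 'q set \<Rightarrow> real) \<Rightarrow> ('q set \<Rightarrow> real) set"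
  where "EqRk \<Phi> = {\<beta> \<in> real_hahn Prin prin_less.
    \<exists>S\<in>Init Prin prin_less. \<not> commensurable \<Phi> S (restr S \<beta>) \<and>
      (\<forall>T\<in>Init Prin prin_less. \<not> commensurable \<Phi> T (restr T \<beta>) \<longrightarrow> S \<subseteq> T) \<and>
      \<beta> = restr S \<beta>}"

text \<open>\<open>cut_ext S b r\<close> is the element \<open>(b | r | 0)\<close> with coordinate \<open>r\<close> at the index \<open>Cut S\<close>.\<close>

definition cut_ext :: "'j set \<Rightarrow> ('j \<Rightarrow> real) \<Rightarrow> real \<Rightarrow> 'j cut_index \<Rightarrow> real"
  where "cut_ext S b r = (zero_ext (restr S b))(Cut S := r)"

definition IncRk :: "('q::linordered_ab_group_add \<Rightarrow> 'q set \<Rightarrow> real) \<Rightarrow> ('q set cut_index \<Rightarrow> real) set"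
  where "IncRk \<Phi> = {cut_ext S b r | S b r. S \<in> Init Prin prin_less \<and>
    b \<in> real_hahn S prin_less \<and> commensurable \<Phi> S b \<and> r \<in> {1, -1}}"

definition Sme :: "('q::linordered_ab_group_add \<Rightarrow> 'q set \<Rightarrow> real) \<Rightarrow> ('q set cut_index \<Rightarrow> real) set"
  where "Sme \<Phi> = zero_ext ` (range \<Phi> \<union> EqRk \<Phi>) \<union> IncRk \<Phi>"

end

theory Submission
  imports Defs
begin

text \<open>If \<open>\<gamma>\<close> is commensurable, \<open>\<beta>\<close> is its image in the divisible hull. Otherwise \<open>\<gamma>\<close> is torsion-free
  modulo the commensurable part, so any \<open>\<beta>\<close> extends the embedding to a unique additive map,
  and this map preserves the order iff \<open>\<beta>\<close> fills the cut which \<open>\<gamma>\<close> defines in the divisible hull.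
  Every cut is filled by reading off coordinates for as long as elements from both sides agree,
  adding one more coordinate if necessary. Two distinct elements of \<open>EqRk\<close> and \<open>IncRk\<close> never
  fill the same cut: below the first index where they differ both are commensurable, and at
  that index the divisible hull can be steered between them.\<close>

subsection \<open>Lexicographic comparison\<close>

text \<open>Steering rests on density at a single index: immediateness supplies, for every index, a
  hull element whose first nonzero coordinate sits there, and its rational multiples are dense at
  that coordinate. The normal forms are what makes \<beta> unique. All positive values at one cut
  index over the same coordinates fill the same cut, so only a sign is kept; and past the least
  segment on which \<beta> is incommensurable, no coordinate influences a comparison with the hull,
  so these are set to 0. The obstacle is that two arbitrary functions need not have a first
  difference, so well-ordered supports are essential. The coordinates of a cut, however, are
  collected from different hull elements, one per index, and their support must be shown to be
  well-ordered.\<close>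

lemma wfp_on_Un:
  assumes "totalp_on (A \<union> B) lt" "transp_on (A \<union> B) lt" "wfp_on A lt" "wfp_on B lt"
  shows "wfp_on (A \<union> B) lt"
  unfolding wfp_on_iff_ex_minimal
proof (intro allI impI)
  fix X
  assume X: "X \<subseteq> A \<union> B" "X \<noteq> {}"
  have min: "\<exists>z\<in>C. \<forall>y. lt y z \<longrightarrow> y \<notin> C" if "C \<subseteq> A \<or> C \<subseteq> B" "C \<noteq> {}" for C
    using assms(3,4) that unfolding wfp_on_iff_ex_minimal by blast
  show "\<exists>z\<in>X. \<forall>y. lt y z \<longrightarrow> y \<notin> X"
  proof (cases "X \<inter> A = {} \<or> X \<inter> B = {}")
    case True
    then show ?thesis using X by (intro min) blast+
  next
    case False
    obtain a where a: "a \<in> X \<inter> A" "\<And>y. lt y a \<Longrightarrow> y \<notin> X \<inter> A"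
      using min[of "X \<inter> A"] False by blast
    obtain b where b: "b \<in> X \<inter> B" "\<And>y. lt y b \<Longrightarrow> y \<notin> X \<inter> B"
      using min[of "X \<inter> B"] False by blast
    have tr: "lt x z" if "lt x y" "lt y z" "x \<in> X" "y \<in> X" "z \<in> X" for x y z
      using assms(2) that X(1) unfolding transp_on_def by blast
    have "a = b \<or> lt a b \<or> lt b a"
      using assms(1) a(1) b(1) unfolding totalp_on_def by blast
    then show ?thesis
    proof (elim disjE)
      assume "a = b"
      then show ?thesis using a b X(1) by blast
    next
      assume "lt a b"
      then have "y \<notin> X" if "lt y a" for y
        using that a b X(1) tr[of y a b] by blast
      then show ?thesis using a by blast
    next
      assume "lt b a"
      then have "y \<notin> X" if "lt y b" for y
        using that a b X(1) tr[of y b a] by blast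
      then show ?thesis using b by blast
    qed
  qed
qed

text \<open>If the two deciding indices differ, the earlier one violates the equality clause of the
  other.\<close>

lemma lex_less_asym:
  fixes f g :: "'j \<Rightarrow> 'a::preorder"
  assumes "totalp_on J lt" "lex_less J lt (<) f g"
  shows "\<not> lex_less J lt (<) g f"
proof
  assume "lex_less J lt (<) g f"
  then obtain l where l: "l \<in> J" "g l < f l" "\<forall>j\<in>J. lt j l \<longrightarrow> g j = f j"
    unfolding lex_less_def by blast
  obtain k where k: "k \<in> J" "f k < g k" "\<forall>j\<in>J. lt j k \<longrightarrow> f j = g j"
    using assms(2) unfolding lex_less_def by blast
  consider "k = l" | "lt k l" | "lt l k"
    using assms(1) k(1) l(1) unfolding totalp_on_def by blast
  then show False
    using k l by cases (auto dest: order_less_asym)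
qed

text \<open>The indices of difference lie in the union of the two supports, which is well-founded
  along with them.\<close>

lemma ex_first_difference:
  fixes f g :: "'j \<Rightarrow> 'a::zero"
  assumes "totalp_on J lt" "transp_on J lt"
    and "wfp_on {j \<in> J. f j \<noteq> 0} lt" "wfp_on {j \<in> J. g j \<noteq> 0} lt"
    and "j \<in> J" "f j \<noteq> g j"
  obtains k where "k \<in> J" "f k \<noteq> g k" "\<And>i. i \<in> J \<Longrightarrow> lt i k \<Longrightarrow> f i = g i"
proof -
  have "wfp_on ({j \<in> J. f j \<noteq> 0} \<union> {j \<in> J. g j \<noteq> 0}) lt"
    using assms(1-4)
    by (intro wfp_on_Un) (auto intro: totalp_on_subset transp_on_subset)
  moreover have "{j \<in> J. f j \<noteq> g j} \<subseteq> {j \<in> J. f j \<noteq> 0} \<union> {j \<in> J. g j \<noteq> 0}"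
    by auto
  moreover have "{j \<in> J. f j \<noteq> g j} \<noteq> {}"
    using assms(5,6) by blast
  ultimately obtain k where "k \<in> {j \<in> J. f j \<noteq> g j}" "\<And>y. lt y k \<Longrightarrow> y \<notin> {j \<in> J. f j \<noteq> g j}"
    unfolding wfp_on_iff_ex_minimal by blast
  then show thesis using that by blast
qed

lemma lex_less_translate:
  fixes f g h :: "'j \<Rightarrow> real"
  shows "lex_less J lt (<) (\<lambda>j. f j + h j) (\<lambda>j. g j + h j) \<longleftrightarrow> lex_less J lt (<) f g"
  unfolding lex_less_def by simp

lemma lex_less_scale:
  fixes f g :: "'j \<Rightarrow> real"
  assumes "c > 0"
  shows "lex_less J lt (<) (\<lambda>j. c * f j) (\<lambda>j. c * g j) \<longleftrightarrow> lex_less J lt (<) f g"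
  using assms unfolding lex_less_def by simp

subsection \<open>Convex subgroups\<close>

lemma add_grp_simps [simp]:
  "carrier (add_grp A) = A" "mult (add_grp A) = (+)" "one (add_grp A) = 0"
  by (simp_all add: add_grp_def)

lemma comm_group_add_grp:
  assumes "0 \<in> A" "\<And>x y. x \<in> A \<Longrightarrow> y \<in> A \<Longrightarrow> x + y \<in> A" "\<And>x. x \<in> A \<Longrightarrow> - x \<in> A"
  shows "comm_group (add_grp A)"
proof (rule comm_groupI)
  show "\<exists>y\<in>carrier (add_grp A). y \<otimes>\<^bsub>add_grp A\<^esub> x = \<one>\<^bsub>add_grp A\<^esub>"
    if "x \<in> carrier (add_grp A)" for x
    using assms(3) that by (intro bexI[of _ "- x"]) auto
qed (use assms in \<open>auto simp: add_ac\<close>)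

lemma group_add_grp_UNIV [simp, intro]: "group (add_grp UNIV)"
  using comm_group_add_grp[of UNIV] by (auto simp: comm_group_def)

lemma inv_add_grp [simp]: "inv\<^bsub>add_grp UNIV\<^esub> x = - x"
  by (rule group.inv_equality) auto

lemma subgroup_add_grp_iff:
  "subgroup H (add_grp UNIV) \<longleftrightarrow> 0 \<in> H \<and> (\<forall>x\<in>H. \<forall>y\<in>H. x + y \<in> H) \<and> (\<forall>x\<in>H. - x \<in> H)"
  unfolding subgroup_def by auto

lemma convex_subgroupD:
  assumes "convex_subgroup H"
  shows "0 \<in> H" "x \<in> H \<Longrightarrow> y \<in> H \<Longrightarrow> x + y \<in> H" "x \<in> H \<Longrightarrow> - x \<in> H"
    "max x (- x) \<le> max y (- y) \<Longrightarrow> y \<in> H \<Longrightarrow> x \<in> H"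
  using assms unfolding convex_subgroup_def subgroup_add_grp_iff by blast+

text \<open>Given an element of each subgroup missing from the other, convexity forces the one of
  smaller absolute value into the other subgroup.\<close>

lemma convex_subgroup_chain:
  assumes "convex_subgroup H" "convex_subgroup K"
  shows "H \<subseteq> K \<or> K \<subseteq> H"
proof (rule ccontr)
  assume "\<not> ?thesis"
  then obtain x y where "x \<in> H" "x \<notin> K" "y \<in> K" "y \<notin> H"
    by blast
  then show False
    using convex_subgroupD(4)[OF assms(1), of y x] convex_subgroupD(4)[OF assms(2), of x y]
    by (metis linorder_le_cases)
qed

lemma convex_subgroup_zero: "convex_subgroup {0}"
  unfolding convex_subgroup_def subgroup_add_grp_iff
  by (auto simp: max_def split: if_splits)

lemma convex_subgroup_hull [simp, intro]: "convex_subgroup (convex_subgroup hull S)"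
proof (rule hull_in)
  fix T :: "'a set set"
  assume T: "Ball T convex_subgroup"
  show "convex_subgroup (\<Inter>T)"
    unfolding convex_subgroup_def subgroup_add_grp_iff
  proof (intro conjI ballI allI impI InterI)
    fix H x y
    assume "H \<in> T"
    then have "convex_subgroup H" using T by blast
    note H = convex_subgroupD[OF this]
    show "0 \<in> H" by (rule H)
    show "x + y \<in> H" if "x \<in> \<Inter>T" "y \<in> \<Inter>T"
      using that \<open>H \<in> T\<close> H(2) by blast
    show "- x \<in> H" if "x \<in> \<Inter>T"
      using that \<open>H \<in> T\<close> H(3) by blast
    show "x \<in> H" if "max x (- x) \<le> max y (- y) \<and> y \<in> \<Inter>T"
      using that \<open>H \<in> T\<close> by (blast intro: H(4)[of x y])
  qed
qed

lemma convex_subgroup_Prin: "i \<in> Prin \<Longrightarrow> convex_subgroup i"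
  by (auto simp: Prin_def)

lemma totalp_on_prin_less: "totalp_on Prin prin_less"
  using convex_subgroup_chain convex_subgroup_Prin unfolding totalp_on_def prin_less_def by blast

lemma prin_less_trans: "prin_less i j \<Longrightarrow> prin_less j k \<Longrightarrow> prin_less i k"
  unfolding prin_less_def by blast

lemma prin_less_irrefl [simp]: "\<not> prin_less i i"
  unfolding prin_less_def by blast

lemma prin_less_linear:
  "i \<in> Prin \<Longrightarrow> j \<in> Prin \<Longrightarrow> prin_less i j \<or> i = j \<or> prin_less j i"
  using totalp_on_prin_less unfolding totalp_on_def by blast

lemma Init_prin_chain:
  assumes "S \<in> Init Prin prin_less" "T \<in> Init Prin prin_less"
  shows "S \<subseteq> T \<or> T \<subseteq> S"
  using assms prin_less_linear unfolding Init_def by blast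

lemma Init_below: "{j \<in> Prin. prin_less j i} \<in> Init Prin prin_less"
  using prin_less_trans unfolding Init_def by blast

lemma Init_not_mem:
  assumes "S \<in> Init Prin prin_less" "i \<in> S" "j \<in> Prin" "j \<notin> S"
  shows "prin_less i j"
  using assms prin_less_linear[of i j] unfolding Init_def by blast

lemma Prin_ex_generator:
  assumes "i \<in> Prin"
  obtains x where "x > 0" "convex_subgroup hull {x} = i"
proof -
  obtain x where x: "i = convex_subgroup hull {x}" "i \<noteq> {0}"
    using assms by (auto simp: Prin_def)
  have "x \<noteq> 0"
  proof
    assume "x = 0"
    then show False
      using x hull_same[of convex_subgroup "{0 :: 'a}"] convex_subgroup_zero by simp
  qed
  have "convex_subgroup hull {- x} = i"
  proof -
    have "convex_subgroup T \<Longrightarrow> - x \<in> T \<longleftrightarrow> x \<in> T" for T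
      using convex_subgroupD(3)[of T x] convex_subgroupD(3)[of T "- x"] by auto
    then have "{T. convex_subgroup T \<and> {- x} \<subseteq> T} = {T. convex_subgroup T \<and> {x} \<subseteq> T}"
      by auto
    then show ?thesis
      unfolding x(1) hull_def by simp
  qed
  with \<open>x \<noteq> 0\<close> x(1) show thesis
    using that[of x] that[of "- x"] by (metis neg_0_less_iff_less linorder_neqE)
qed

text \<open>\<open>star\<close> is given by \<open>GREATEST\<close>, which says nothing until a
  greatest proper convex subgroup is exhibited. It is the union of all of them: they form a chain,
  so the union is closed under addition, and none of them contains a generator of \<open>i\<close>,
  so it is proper.\<close>

lemma star_Prin:
  assumes "i \<in> Prin"
  shows "convex_subgroup (star i)" "star i \<subset> i"
proof -
  obtain x where x: "x > 0" "convex_subgroup hull {x} = i"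
    using Prin_ex_generator[OF assms] .
  define M where "M = \<Union>{K. convex_subgroup K \<and> K \<subset> i}"
  have mem: "x \<notin> K" if "convex_subgroup K" "K \<subset> i" for K
    using that x hull_minimal[of "{x}" K convex_subgroup] by auto
  have "0 \<in> i" "x \<in> i" "x \<noteq> 0"
    using x convex_subgroupD(1)[OF convex_subgroup_Prin[OF assms]] hull_inc[of x "{x}" convex_subgroup]
    by auto
  then have "{0} \<subset> i"
    by blast
  have "convex_subgroup M"
    unfolding convex_subgroup_def subgroup_add_grp_iff
  proof (intro conjI ballI allI impI)
    show "0 \<in> M" unfolding M_def using convex_subgroup_zero \<open>{0} \<subset> i\<close> by blast
    show "a + b \<in> M" if "a \<in> M" "b \<in> M" for a b
    proof -
      obtain K L where KL: "convex_subgroup K" "K \<subset> i" "a \<in> K" "convex_subgroup L" "L \<subset> i" "b \<in> L"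
        using \<open>a \<in> M\<close> \<open>b \<in> M\<close> unfolding M_def by blast
      then show ?thesis
        unfolding M_def using convex_subgroup_chain[of K L] convex_subgroupD(2) by blast
    qed
    show "- a \<in> M" if "a \<in> M" for a
      using that convex_subgroupD(3) unfolding M_def by blast
    show "a \<in> M" if "max a (- a) \<le> max b (- b) \<and> b \<in> M" for a b
      using that convex_subgroupD(4) unfolding M_def by blast
  qed
  moreover have "M \<subset> i"
  proof -
    have "M \<subseteq> i" "x \<notin> M" unfolding M_def using mem by blast+
    then show ?thesis using x hull_inc[of x "{x}" convex_subgroup] by blast
  qed
  ultimately have "star i = M"
    unfolding star_def by (intro Greatest_equality) (auto simp: M_def)
  then show "convex_subgroup (star i)" "star i \<subset> i"
    using \<open>convex_subgroup M\<close> \<open>M \<subset> i\<close> by simp_all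
qed

lemma generator_notin_star:
  assumes "i \<in> Prin" "convex_subgroup hull {x} = i"
  shows "x \<notin> star i"
  using star_Prin[OF assms(1)] assms(2) hull_minimal[of "{x}" "star i" convex_subgroup] by auto

lemma Quot_Prin:
  assumes "i \<in> Prin"
  shows "group (Quot i)" "\<one>\<^bsub>Quot i\<^esub> = star i"
proof -
  note i = convex_subgroupD[OF convex_subgroup_Prin[OF assms]]
  note s = convex_subgroupD[OF star_Prin(1)[OF assms]]
  interpret comm_group "add_grp i"
    using i by (intro comm_group_add_grp) auto
  have inv: "inv\<^bsub>add_grp i\<^esub> x = - x" if "x \<in> i" for x
    using that i by (intro inv_equality) auto
  have "subgroup (star i) (add_grp i)"
    using s inv star_Prin(2)[OF assms] unfolding subgroup_def by auto
  then have "star i \<lhd> add_grp i"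
    by (rule subgroup_imp_normal)
  then show "group (Quot i)"
    unfolding Quot_def by (rule normal.factorgroup_is_group)
  show "\<one>\<^bsub>Quot i\<^esub> = star i"
    unfolding Quot_def FactGroup_def by simp
qed

subsection \<open>The divisible hull in the real Hahn product\<close>

text \<open>What the argument retains of the composite of the embeddings \<open>e\<close> and
  \<open>\<phi>\<close>. Immediateness survives as \<open>leading\<close>, which is the source of
  all density arguments.\<close>

locale hull_embedding =
  fixes \<Phi> :: "'q::linordered_ab_group_add \<Rightarrow> 'q set \<Rightarrow> real"
  assumes divisible: "n > 0 \<Longrightarrow> \<exists>y. nsmul n y = x"
    and add: "\<Phi> (x + y) i = \<Phi> x i + \<Phi> y i"
    and outside: "i \<notin> Prin \<Longrightarrow> \<Phi> x i = 0"
    and wf_support: "wfp_on {i \<in> Prin. \<Phi> x i \<noteq> 0} prin_less"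
    and mono: "x < y \<Longrightarrow> lex_less Prin prin_less (<) (\<Phi> x) (\<Phi> y)"
    and leading: "i \<in> Prin \<Longrightarrow> \<exists>d. \<Phi> d i > 0 \<and> (\<forall>j\<in>Prin. prin_less j i \<longrightarrow> \<Phi> d j = 0)"

text \<open>The denominator is \<open>Suc m\<close> so that the lift is total: pairs with second
  component 0 are outside the domain of \<open>frac_rel\<close>.\<close>

lift_definition dfrac :: "'a::linordered_ab_group_add \<Rightarrow> nat \<Rightarrow> 'a dhull" is "\<lambda>a m. (a, Suc m)"
  by (simp add: frac_rel_def)

lemma dfrac_add: "dfrac a m + dfrac b m = dfrac (a + b) m"
  by transfer (simp add: frac_rel_def nsmul_add nsmul_mult)

lemma dfrac_zero: "dfrac 0 m = 0"
  by transfer (simp add: frac_rel_def)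

lemma nsmul_dfrac: "nsmul n (dfrac a m) = dfrac (nsmul n a) m"
proof (induction n)
  case 0
  then show ?case by (simp add: nsmul_def dfrac_zero)
qed (simp add: nsmul_Suc dfrac_add)

lemma ex_dfrac: "\<exists>a m. x = dfrac a m"
proof transfer
  fix x :: "'a \<times> nat"
  assume "frac_rel x x"
  then show "\<exists>a m. frac_rel x (a, Suc m)"
    by (intro exI[of _ "fst x"] exI[of _ "snd x - 1"]) (auto simp: frac_rel_def)
qed

lemma dhull_divisible:
  fixes x :: "'g::linordered_ab_group_add dhull"
  assumes "n > 0"
  shows "\<exists>y. nsmul n y = x"
proof -
  obtain a m where x: "x = dfrac a m"
    using ex_dfrac by blast
  \<comment> \<open>Dividing by \<open>n\<close> multiplies the denominator by \<open>n\<close>;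
    \<open>dfrac\<close> stores the denominator minus one.\<close>
  have "dfrac (nsmul n a) (n * Suc m - 1) = dfrac a m"
    using assms by transfer (auto simp: frac_rel_def nsmul_mult mult_ac)
  then show ?thesis
    unfolding x by (intro exI[of _ "dfrac a (n * Suc m - 1)"]) (simp add: nsmul_dfrac)
qed

lemma ex_nsmul_eq_to_dhull:
  fixes x :: "'g::linordered_ab_group_add dhull"
  shows "\<exists>n a. n > 0 \<and> nsmul n x = to_dhull a"
proof -
  obtain a m where x: "x = dfrac a m"
    using ex_dfrac by blast
  have "dfrac (nsmul (Suc m) a) m = to_dhull a"
    by transfer (simp add: frac_rel_def)
  then show ?thesis
    unfolding x by (intro exI[of _ "Suc m"] exI[of _ a]) (simp add: nsmul_dfrac)
qed

lemma hull_embedding_hull_emb: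
  fixes e :: "'g::linordered_ab_group_add dhull set \<Rightarrow> 'g dhull set \<Rightarrow> real"
  assumes e: "quot_embeddings e" and \<phi>: "immediate_embedding \<phi>"
  shows "hull_embedding (hull_emb e \<phi>)"
proof
  let ?\<Phi> = "hull_emb e \<phi>"
  have e_hom: "e i \<in> hom (Quot i) (add_grp UNIV)"
    and e_mono: "A \<in> carrier (Quot i) \<Longrightarrow> B \<in> carrier (Quot i) \<Longrightarrow> coset_less A B \<Longrightarrow> e i A < e i B"
    if "i \<in> Prin" for i A B
    using e that unfolding quot_embeddings_def by blast+
  have \<phi>_hahn: "\<phi> x \<in> hahn_product Prin prin_less Quot" for x
    using \<phi> rangeI unfolding immediate_embedding_def by fast
  have \<phi>_hom: "(\<lambda>x. \<phi> x i) \<in> hom (add_grp UNIV) (Quot i)" if "i \<in> Prin" for i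
    using \<phi> that unfolding immediate_embedding_def by blast
  then have \<phi>_carrier: "\<phi> x i \<in> carrier (Quot i)" if "i \<in> Prin" for i x
    using that unfolding hom_def by auto
  have e_one: "e i (\<one>\<^bsub>Quot i\<^esub>) = 0" if "i \<in> Prin" for i
    using hom_one[OF e_hom[OF that] Quot_Prin(1)[OF that]] by simp
  have \<phi>_add: "\<phi> (x + y) i = \<phi> x i \<otimes>\<^bsub>Quot i\<^esub> \<phi> y i" if "i \<in> Prin" for i x y
    using hom_mult[OF \<phi>_hom[OF that], of x y] by simp
  fix x y :: "'g dhull" and i :: "'g dhull set"
  show "\<exists>y. nsmul n y = x" if "n > 0" for n
    using dhull_divisible[OF that] .
  show "?\<Phi> (x + y) i = ?\<Phi> x i + ?\<Phi> y i"
    using hom_mult[OF e_hom \<phi>_carrier \<phi>_carrier] unfolding hull_emb_def by (simp add: \<phi>_add)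
  show "?\<Phi> x i = 0" if "i \<notin> Prin"
    using that by (simp add: hull_emb_def)
  have "wfp_on {j \<in> Prin. \<phi> x j \<noteq> \<one>\<^bsub>Quot j\<^esub>} prin_less"
    using \<phi>_hahn[of x] unfolding hahn_product_def by simp
  then show "wfp_on {i \<in> Prin. ?\<Phi> x i \<noteq> 0} prin_less"
  proof (rule wfp_on_subset)
    show "{i \<in> Prin. ?\<Phi> x i \<noteq> 0} \<subseteq> {j \<in> Prin. \<phi> x j \<noteq> \<one>\<^bsub>Quot j\<^esub>}"
    proof (rule subsetI, rule CollectI, rule conjI)
      fix j
      assume j: "j \<in> {i \<in> Prin. ?\<Phi> x i \<noteq> 0}"
      then show "j \<in> Prin" by simp
      with j have "e j (\<phi> x j) \<noteq> 0" by (simp add: hull_emb_def)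
      then show "\<phi> x j \<noteq> \<one>\<^bsub>Quot j\<^esub>"
        using e_one[OF \<open>j \<in> Prin\<close>] by metis
    qed
  qed
  show "lex_less Prin prin_less (<) (?\<Phi> x) (?\<Phi> y)" if "x < y"
  proof -
    have "lex_less Prin prin_less coset_less (\<phi> x) (\<phi> y)"
      using \<phi> that unfolding immediate_embedding_def by blast
    then obtain k where "k \<in> Prin" "coset_less (\<phi> x k) (\<phi> y k)"
      "\<forall>j\<in>Prin. prin_less j k \<longrightarrow> \<phi> x j = \<phi> y j"
      unfolding lex_less_def by blast
    then show ?thesis
      unfolding lex_less_def hull_emb_def using e_mono \<phi>_carrier by (intro bexI[of _ k]) auto
  qed
  show "\<exists>d. ?\<Phi> d i > 0 \<and> (\<forall>j\<in>Prin. prin_less j i \<longrightarrow> ?\<Phi> d j = 0)" if i: "i \<in> Prin"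
  proof -
    obtain d where d: "d > 0" "convex_subgroup hull {d} = i"
      using Prin_ex_generator[OF i] .
    have lead: "\<forall>j\<in>Prin. prin_less j i \<longrightarrow> \<phi> d j = \<one>\<^bsub>Quot j\<^esub>" "\<phi> d i = star i #>\<^bsub>add_grp i\<^esub> d"
      using \<phi> i d(2) unfolding immediate_embedding_def by blast+
    note s = convex_subgroupD[OF star_Prin(1)[OF i]]
    \<comment> \<open>The neutral class is \<open>star i\<close>, the class of \<open>d\<close> its
      translate by \<open>d\<close>. If they were not separated, \<open>d\<close> would be bounded
      by the element \<open>a - s\<close> of \<open>star i\<close>, and convexity would put the
      generator \<open>d\<close> into \<open>star i\<close>.\<close>
    have "a < s + d" if "a \<in> star i" "s \<in> star i" for a s
    proof (rule ccontr)
      assume "\<not> a < s + d"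
      then have "d \<le> a - s" by (simp add: algebra_simps)
      moreover have "a - s \<in> star i"
        using s(2)[OF that(1) s(3)[OF that(2)]] by simp
      moreover have "max d (- d) = d"
        using \<open>d > 0\<close> by (intro max_absorb1) (simp add: order_less_imp_le less_imp_le)
      ultimately have "d \<in> star i"
        using s(4)[of d "a - s"] by (simp add: le_max_iff_disj)
      with generator_notin_star[OF i d(2)] show False by blast
    qed
    then have "coset_less (\<one>\<^bsub>Quot i\<^esub>) (\<phi> d i)"
      unfolding coset_less_def Quot_Prin(2)[OF i] lead(2) r_coset_def by auto
    then have "e i (\<one>\<^bsub>Quot i\<^esub>) < e i (\<phi> d i)"
      using \<phi>_carrier[OF i] group.is_monoid[OF Quot_Prin(1)[OF i]] i
      by (intro e_mono) (auto intro: monoid.one_closed)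
    then show ?thesis
      using lead(1) i by (intro exI[of _ d]) (auto simp: hull_emb_def e_one)
  qed
qed

context hull_embedding
begin

lemma zero [simp]: "\<Phi> 0 i = 0"
  using add[of 0 0 i] by simp

lemma uminus: "\<Phi> (- x) i = - \<Phi> x i"
  using add[of x "- x" i] by simp

lemma nsmul: "\<Phi> (nsmul n x) i = real n * \<Phi> x i"
proof (induction n)
  case 0
  then show ?case by (simp add: nsmul_def)
qed (simp add: nsmul_Suc add algebra_simps)

text \<open>Converse of \<open>mono\<close>: the hull is totally ordered, so a failure of
  \<open>x < y\<close> would contradict the asymmetry of the lexicographic order.\<close>

lemma lessI:
  assumes "k \<in> Prin" "\<Phi> x k < \<Phi> y k" "\<And>j. j \<in> Prin \<Longrightarrow> prin_less j k \<Longrightarrow> \<Phi> x j = \<Phi> y j"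
  shows "x < y"
proof -
  have "lex_less Prin prin_less (<) (\<Phi> x) (\<Phi> y)"
    using assms unfolding lex_less_def by blast
  then show ?thesis
    using mono[of y x] lex_less_asym[OF totalp_on_prin_less]
    by (cases x y rule: linorder_cases) blast+
qed

lemma lessE:
  assumes "x < y"
  obtains k where "k \<in> Prin" "\<Phi> x k < \<Phi> y k"
    "\<And>j. j \<in> Prin \<Longrightarrow> prin_less j k \<Longrightarrow> \<Phi> x j = \<Phi> y j"
  using mono[OF assms] unfolding lex_less_def by blast

text \<open>Hull elements with prescribed coordinates on an initial segment form a convex set. If
  the index deciding \<open>x < y\<close> were in \<open>S\<close>, then at the earlier of it and
  the index deciding \<open>y < z\<close> the outer elements \<open>x\<close> and \<open>z\<close>
  would differ inside \<open>S\<close>.\<close>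

lemma sandwich:
  assumes "x \<le> y" "y \<le> z" "S \<in> Init Prin prin_less" "\<And>i. i \<in> S \<Longrightarrow> \<Phi> x i = \<Phi> z i" "i \<in> S"
  shows "\<Phi> y i = \<Phi> x i"
proof (cases "x = y \<or> y = z")
  case True
  then show ?thesis using assms(4,5) by auto
next
  case False
  then have "x < y" "y < z" using assms(1,2) by auto
  obtain k where k: "k \<in> Prin" "\<Phi> x k < \<Phi> y k" "\<And>j. j \<in> Prin \<Longrightarrow> prin_less j k \<Longrightarrow> \<Phi> x j = \<Phi> y j"
    using lessE[OF \<open>x < y\<close>] by blast
  obtain l where l: "l \<in> Prin" "\<Phi> y l < \<Phi> z l" "\<And>j. j \<in> Prin \<Longrightarrow> prin_less j l \<Longrightarrow> \<Phi> y j = \<Phi> z j"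
    using lessE[OF \<open>y < z\<close>] by blast
  have "k \<notin> S"
  proof
    assume "k \<in> S"
    consider "k = l" | "prin_less k l" | "prin_less l k"
      using prin_less_linear k(1) l(1) by blast
    then show False
    proof cases
      case 1
      then show ?thesis using k(2) l(2) assms(4)[OF \<open>k \<in> S\<close>] by simp
    next
      case 2
      then show ?thesis using k(1,2) l(3) assms(4)[OF \<open>k \<in> S\<close>] by fastforce
    next
      case 3
      then have "l \<in> S" using assms(3) \<open>k \<in> S\<close> l(1) unfolding Init_def by blast
      then show ?thesis using k(3)[OF l(1) 3] l(2) assms(4) by fastforce
    qed
  qed
  then have "prin_less i k" "i \<in> Prin"
    using Init_not_mem[OF assms(3,5) k(1)] assms(3,5) unfolding Init_def by blast+
  then show ?thesis using k(3) by simp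
qed

lemma rational_multiple:
  assumes "r \<in> \<rat>"
  obtains y where "\<And>i. \<Phi> y i = r * \<Phi> x i"
proof -
  obtain a n where r: "r = real_of_int a / real n" "n \<noteq> 0"
    using assms unfolding Rats_eq_int_div_nat by blast
  obtain y where y: "nsmul n y = x"
    using divisible[of n] r(2) by auto
  have "real n * \<Phi> y i = \<Phi> x i" for i
    using nsmul[of n y i] y by simp
  then have x: "\<Phi> y i = \<Phi> x i / real n" for i
    using r(2) by (simp add: field_simps)
  show thesis
  proof (cases "a \<ge> 0")
    case True
    then show thesis
      using that[of "nsmul (nat a) y"] r by (simp add: nsmul x)
  next
    case False
    then show thesis
      using that[of "- nsmul (nat (- a)) y"] r by (simp add: nsmul x uminus)
  qed
qed

text \<open>Add to \<open>c\<close> a rational multiple of an element whose first nonzero coordinate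
  is at \<open>i\<close>: nothing changes before \<open>i\<close>, and by density of the rationals
  the coordinate at \<open>i\<close> can be moved into any open interval.\<close>

lemma interpolate:
  assumes "i \<in> Prin" "lo < hi"
  obtains q where "\<And>j. j \<in> Prin \<Longrightarrow> prin_less j i \<Longrightarrow> \<Phi> q j = \<Phi> c j" "lo < \<Phi> q i" "\<Phi> q i < hi"
proof -
  obtain d where d: "\<Phi> d i > 0" "\<And>j. j \<in> Prin \<Longrightarrow> prin_less j i \<Longrightarrow> \<Phi> d j = 0"
    using leading[OF assms(1)] by blast
  have "(lo - \<Phi> c i) / \<Phi> d i < (hi - \<Phi> c i) / \<Phi> d i"
    using d(1) assms(2) by (simp add: divide_strict_right_mono)
  then obtain r where r: "r \<in> \<rat>" "(lo - \<Phi> c i) / \<Phi> d i < r" "r < (hi - \<Phi> c i) / \<Phi> d i"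
    using Rats_dense_in_real by blast
  obtain y where y: "\<And>j. \<Phi> y j = r * \<Phi> d j"
    using rational_multiple[OF r(1)] by blast
  show thesis
    using that[of "c + y"] r(2,3) d by (simp add: add y field_simps)
qed

section \<open>A common normal form for minimal incommensurable elements and signed cuts\<close>

definition comm_on :: "'q set set \<Rightarrow> ('q set cut_index \<Rightarrow> real) \<Rightarrow> bool"
  where "comm_on S \<beta> \<longleftrightarrow> (\<exists>b. \<forall>i\<in>S. \<beta> (Pt i) = \<Phi> b i)"

lemma comm_on_subset: "comm_on S \<beta> \<Longrightarrow> R \<subseteq> S \<Longrightarrow> comm_on R \<beta>"
  unfolding comm_on_def by blast

lemma commensurable_restr_iff:
  "commensurable \<Phi> S (restr S \<beta>) \<longleftrightarrow> comm_on S (zero_ext \<beta>)"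
  unfolding commensurable_def comm_on_def restr_def fun_eq_iff by (auto; metis)

text \<open>The elements of \<open>EqRk \<Phi>\<close> and \<open>IncRk \<Phi>\<close> in one form: \<open>S\<close> is the segment carrying the
  coordinates in \<open>Prin\<close>, and its cut coordinate is non-zero exactly in the commensurable case.\<close>

definition cut_element :: "'q set set \<Rightarrow> ('q set cut_index \<Rightarrow> real) \<Rightarrow> bool"
  where "cut_element S \<beta> \<longleftrightarrow> S \<in> Init Prin prin_less \<and>
    wfp_on {i \<in> Prin. \<beta> (Pt i) \<noteq> 0} prin_less \<and>
    (\<forall>i. i \<notin> S \<longrightarrow> \<beta> (Pt i) = 0) \<and>
    (\<forall>R\<in>Init Prin prin_less. R \<subset> S \<longrightarrow> comm_on R \<beta>) \<and>
    (\<forall>R. R \<noteq> S \<longrightarrow> \<beta> (Cut R) = 0) \<and>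
    (if comm_on S \<beta> then \<beta> (Cut S) \<in> {1, -1} else \<beta> (Cut S) = 0)"

lemma cut_elementD:
  assumes "cut_element S \<beta>"
  shows "S \<in> Init Prin prin_less" "wfp_on {i \<in> Prin. \<beta> (Pt i) \<noteq> 0} prin_less"
    "i \<notin> S \<Longrightarrow> \<beta> (Pt i) = 0" "R \<in> Init Prin prin_less \<Longrightarrow> R \<subset> S \<Longrightarrow> comm_on R \<beta>"
    "R \<noteq> S \<Longrightarrow> \<beta> (Cut R) = 0" "comm_on S \<beta> \<Longrightarrow> \<beta> (Cut S) = 1 \<or> \<beta> (Cut S) = -1"
    "\<not> comm_on S \<beta> \<Longrightarrow> \<beta> (Cut S) = 0"
  using assms unfolding cut_element_def by (auto split: if_splits)

lemma cut_element_zero_ext: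
  assumes "\<beta> \<in> EqRk \<Phi>"
  shows "\<exists>S. cut_element S (zero_ext \<beta>)"
proof -
  obtain S where S: "S \<in> Init Prin prin_less" "\<not> comm_on S (zero_ext \<beta>)"
    "\<And>T. T \<in> Init Prin prin_less \<Longrightarrow> \<not> comm_on T (zero_ext \<beta>) \<Longrightarrow> S \<subseteq> T" "\<beta> = restr S \<beta>"
    using assms unfolding EqRk_def commensurable_restr_iff by blast
  have "\<beta> \<in> real_hahn Prin prin_less"
    using assms unfolding EqRk_def by blast
  then have "wfp_on {i \<in> Prin. \<beta> i \<noteq> 0} prin_less"
    unfolding real_hahn_def hahn_product_def by simp
  moreover have "\<beta> i = 0" if "i \<notin> S" for i
    using fun_cong[OF S(4), of i] that by (simp add: restr_def)
  ultimately have "cut_element S (zero_ext \<beta>)"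
    unfolding cut_element_def using S(1,2,3) by auto
  then show ?thesis ..
qed

lemma cut_element_IncRk:
  assumes "\<beta> \<in> IncRk \<Phi>"
  shows "\<exists>S. cut_element S \<beta>"
proof -
  obtain S b r where *: "\<beta> = cut_ext S b r" "S \<in> Init Prin prin_less"
    "commensurable \<Phi> S b" "r \<in> {1, -1}"
    using assms unfolding IncRk_def by blast
  obtain c where c: "b = restr S (\<Phi> c)"
    using *(3) unfolding commensurable_def by blast
  have Pt: "\<beta> (Pt i) = (if i \<in> S then \<Phi> c i else 0)" for i
    using * c by (simp add: cut_ext_def restr_def)
  have Cut: "\<beta> (Cut R) = (if R = S then r else 0)" for R
    using * by (simp add: cut_ext_def)
  have "wfp_on {i \<in> Prin. \<beta> (Pt i) \<noteq> 0} prin_less"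
    by (rule wfp_on_subset[OF wf_support[of c]]) (auto simp: Pt)
  moreover have "comm_on R \<beta>" if "R \<subseteq> S" for R
    using that unfolding comm_on_def by (intro exI[of _ c]) (auto simp: Pt)
  ultimately have "cut_element S \<beta>"
    unfolding cut_element_def using *(2,4) by (auto simp: Pt Cut)
  then show ?thesis ..
qed

text \<open>Converse of the two preceding lemmas. If \<beta> is incommensurable on \<open>S\<close>,
  then \<open>S\<close> is the smallest such segment because initial segments form a chain and those
  properly inside \<open>S\<close> are commensurable.\<close>

lemma cut_element_mem:
  assumes "cut_element S \<beta>"
  shows "\<beta> \<in> zero_ext ` EqRk \<Phi> \<union> IncRk \<Phi>"
proof (cases "comm_on S \<beta>")
  case True
  then obtain c where c: "\<And>i. i \<in> S \<Longrightarrow> \<beta> (Pt i) = \<Phi> c i"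
    unfolding comm_on_def by blast
  have "S \<subseteq> Prin" using cut_elementD(1)[OF assms] unfolding Init_def by blast
  have "restr S (\<Phi> c) \<in> real_hahn S prin_less"
    unfolding real_hahn_def hahn_product_def restr_def
    using wfp_on_subset[OF wf_support[of c], of "{j \<in> S. \<Phi> c j \<noteq> 0}"] \<open>S \<subseteq> Prin\<close>
    by (auto cong: conj_cong)
  moreover have "\<beta> = cut_ext S (restr S (\<Phi> c)) (\<beta> (Cut S))"
  proof
    show "\<beta> k = cut_ext S (restr S (\<Phi> c)) (\<beta> (Cut S)) k" for k
      using c cut_elementD(3,5)[OF assms] by (cases k) (auto simp: cut_ext_def restr_def)
  qed
  ultimately have "\<beta> \<in> IncRk \<Phi>"
    unfolding IncRk_def commensurable_def using cut_elementD(1,6)[OF assms] True by blast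
  then show ?thesis ..
next
  case False
  define b where "b = (\<lambda>i. \<beta> (Pt i))"
  have \<beta>: "\<beta> = zero_ext b"
  proof
    show "\<beta> k = zero_ext b k" for k
      using cut_elementD(5)[OF assms] cut_elementD(7)[OF assms False]
      by (cases k; cases "k = Cut S") (auto simp: b_def)
  qed
  have "S \<subseteq> Prin" using cut_elementD(1)[OF assms] unfolding Init_def by blast
  then have "b \<in> real_hahn Prin prin_less"
    unfolding real_hahn_def hahn_product_def b_def using cut_elementD(2,3)[OF assms] by auto
  moreover have "b = restr S b"
    using cut_elementD(3)[OF assms] by (auto simp: fun_eq_iff restr_def b_def)
  moreover have "S \<subseteq> T" if "T \<in> Init Prin prin_less" "\<not> comm_on T \<beta>" for T
    using Init_prin_chain[OF cut_elementD(1)[OF assms] that(1)] cut_elementD(4)[OF assms that(1)]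
      that(2) by blast
  ultimately have "b \<in> EqRk \<Phi>"
    using cut_elementD(1)[OF assms] False unfolding EqRk_def commensurable_restr_iff \<beta> by blast
  then show ?thesis unfolding \<beta> by blast
qed

section \<open>Comparison of elements and the total order of the cut indices\<close>

lemma sme_less_PtI:
  assumes "i \<in> Prin" "f (Pt i) < g (Pt i)"
    "\<And>j. j \<in> Prin \<Longrightarrow> prin_less j i \<Longrightarrow> f (Pt j) = g (Pt j)"
    "\<And>R. R \<in> Init Prin prin_less \<Longrightarrow> i \<notin> R \<Longrightarrow> f (Cut R) = g (Cut R)"
  shows "sme_less f g"
  unfolding sme_less_def lex_less_def
  by (rule bexI[of _ "Pt i"]) (use assms in \<open>auto simp: cut_indices_def\<close>)

lemma sme_less_CutI:
  assumes "S \<in> Init Prin prin_less" "f (Cut S) < g (Cut S)"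
    "\<And>i. i \<in> S \<Longrightarrow> f (Pt i) = g (Pt i)"
    "\<And>R. R \<in> Init Prin prin_less \<Longrightarrow> R \<subset> S \<Longrightarrow> f (Cut R) = g (Cut R)"
  shows "sme_less f g"
  unfolding sme_less_def lex_less_def
  by (rule bexI[of _ "Cut S"]) (use assms in \<open>auto simp: cut_indices_def\<close>)

lemma totalp_on_prin_cuts: "totalp_on (prin_cuts :: 'q set cut_index set) (cut_less prin_less)"
proof (rule totalp_onI)
  fix k l :: "'q set cut_index"
  assume kl: "k \<in> prin_cuts" "l \<in> prin_cuts" "k \<noteq> l"
  show "cut_less prin_less k l \<or> cut_less prin_less l k"
  proof (cases k; cases l)
    fix R S assume "k = Cut R" "l = Cut S"
    then show ?thesis using kl Init_prin_chain[of R S] unfolding cut_indices_def by auto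
  next
    fix i j assume "k = Pt i" "l = Pt j"
    then show ?thesis using kl prin_less_linear[of i j] unfolding cut_indices_def by auto
  qed auto
qed

lemma transp_on_prin_cuts: "transp_on (prin_cuts :: 'q set cut_index set) (cut_less prin_less)"
proof (rule transp_onI)
  fix k l m :: "'q set cut_index"
  assume mem: "k \<in> prin_cuts" "l \<in> prin_cuts" "m \<in> prin_cuts"
    and less: "cut_less prin_less k l" "cut_less prin_less l m"
  have Init: "j \<in> S" if "S \<in> Init Prin prin_less" "i \<in> S" "j \<in> Prin" "prin_less j i"
    for S and i j :: "'q set"
    using that unfolding Init_def by blast
  have Pt: "Pt i \<in> prin_cuts \<longleftrightarrow> i \<in> Prin" and Cut: "Cut S \<in> prin_cuts \<longleftrightarrow> S \<in> Init Prin prin_less"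
    for i :: "'q set" and S
    unfolding cut_indices_def by auto
  show "cut_less prin_less k m"
  proof (cases k)
    case k: (Pt i)
    show ?thesis
    proof (cases l)
      case l: (Pt j)
      show ?thesis
        using mem less k l Init prin_less_trans by (cases m) (auto simp: Pt Cut)
    next
      case l: (Cut S)
      show ?thesis
        using mem less k l Init_not_mem by (cases m) (auto simp: Pt Cut)
    qed
  next
    case k: (Cut R)
    show ?thesis
    proof (cases l)
      case l: (Pt j)
      show ?thesis
      proof (cases m)
        case m: (Pt h)
        then show ?thesis using mem less k l Init[of R h j] by (auto simp: Pt Cut)
      next
        case m: (Cut S)
        then show ?thesis using mem less k l Init_prin_chain[of R S] by (auto simp: Pt Cut)
      qed
    next
      case l: (Cut S)
      show ?thesis using mem less k l by (cases m) auto
    qed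
  qed
qed

text \<open>Besides the well-ordered support in \<open>Prin\<close>, only the single index
  \<open>Cut S\<close> can carry a nonzero value.\<close>

lemma wfp_on_cut_element:
  assumes "cut_element S \<beta>"
  shows "wfp_on {k \<in> prin_cuts. \<beta> k \<noteq> 0} (cut_less prin_less)"
proof -
  let ?A = "Pt ` {i \<in> Prin. \<beta> (Pt i) \<noteq> 0}"
  have sub: "?A \<union> {Cut S} \<subseteq> prin_cuts"
    using cut_elementD(1)[OF assms] unfolding cut_indices_def by auto
  have "wfp_on ?A (cut_less prin_less)"
    unfolding wfp_on_image using cut_elementD(2)[OF assms] by simp
  moreover have "wfp_on {Cut S} (cut_less prin_less)"
    unfolding wfp_on_iff_ex_minimal by (auto dest!: subset_singletonD)
  ultimately have "wfp_on (?A \<union> {Cut S}) (cut_less prin_less)"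
    using sub totalp_on_prin_cuts transp_on_prin_cuts
    by (intro wfp_on_Un) (auto intro: totalp_on_subset transp_on_subset)
  then show ?thesis
    by (rule wfp_on_subset) (use cut_elementD(5)[OF assms] in \<open>auto simp: cut_indices_def\<close>)
qed

subsection \<open>Uniqueness: separating two cuts\<close>

text \<open>Here minimality of \<open>S\<close> enters: the indices before \<open>i\<close> form a
  proper initial segment of \<open>S\<close>, so \<beta> is commensurable there even when it is not
  on \<open>S\<close>.\<close>

lemma cut_element_below:
  assumes "cut_element S \<beta>" "i \<in> S"
  obtains c where "\<And>j. j \<in> Prin \<Longrightarrow> prin_less j i \<Longrightarrow> \<beta> (Pt j) = \<Phi> c j"
proof -
  have "{j \<in> Prin. prin_less j i} \<subset> S"
    using cut_elementD(1)[OF assms(1)] assms(2) unfolding Init_def by auto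
  then show thesis
    using that cut_elementD(4)[OF assms(1) Init_below] unfolding comm_on_def by blast
qed

text \<open>For the case that two elements first differ at \<open>Cut R\<close> and \<beta> is the
  one with value 0 there. Then \<beta> continues past \<open>R\<close>, and at a later index of its
  segment hull elements agreeing with it on \<open>R\<close> can be placed on either side.\<close>

lemma beyond:
  assumes \<beta>: "cut_element S \<beta>" and R: "R \<in> Init Prin prin_less" "comm_on R \<beta>"
    and Cut0: "\<And>T. T \<in> Init Prin prin_less \<Longrightarrow> T \<subseteq> R \<Longrightarrow> \<beta> (Cut T) = 0"
  obtains p q where
    "\<And>i. i \<in> R \<Longrightarrow> \<Phi> p i = \<beta> (Pt i)" "sme_less (zero_ext (\<Phi> p)) \<beta>"
    "\<And>i. i \<in> R \<Longrightarrow> \<Phi> q i = \<beta> (Pt i)" "sme_less \<beta> (zero_ext (\<Phi> q))"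
proof -
  note S = cut_elementD(1)[OF \<beta>]
  \<comment> \<open>Otherwise \<beta> would be commensurable on \<open>S\<close> and carry a sign at
    \<open>Cut S\<close>, against \<open>Cut0\<close>.\<close>
  have "\<not> S \<subseteq> R"
  proof
    assume "S \<subseteq> R"
    then have "comm_on S \<beta>" using comm_on_subset[OF R(2)] by blast
    then show False
      using cut_elementD(6)[OF \<beta>] Cut0[OF S \<open>S \<subseteq> R\<close>] by auto
  qed
  then obtain j where j: "j \<in> S" "j \<notin> R" by blast
  have jP: "j \<in> Prin" using S j(1) unfolding Init_def by blast
  have below: "i \<in> Prin \<and> prin_less i j" if "i \<in> R" for i
    using Init_not_mem[OF R(1) that jP j(2)] that R(1) unfolding Init_def by blast
  obtain c where c: "\<And>i. i \<in> Prin \<Longrightarrow> prin_less i j \<Longrightarrow> \<beta> (Pt i) = \<Phi> c i"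
    using cut_element_below[OF \<beta> j(1)] by blast
  obtain p where p: "\<And>i. i \<in> Prin \<Longrightarrow> prin_less i j \<Longrightarrow> \<Phi> p i = \<Phi> c i" "\<Phi> p j < \<beta> (Pt j)"
    using interpolate[OF jP, of "\<beta> (Pt j) - 1" "\<beta> (Pt j)" c] by auto
  obtain q where q: "\<And>i. i \<in> Prin \<Longrightarrow> prin_less i j \<Longrightarrow> \<Phi> q i = \<Phi> c i" "\<beta> (Pt j) < \<Phi> q j"
    using interpolate[OF jP, of "\<beta> (Pt j)" "\<beta> (Pt j) + 1" c] by auto
  have Cut: "\<beta> (Cut T) = 0" if "j \<notin> T" for T
    using cut_elementD(5)[OF \<beta>, of T] that j(1) by blast
  show thesis
  proof (rule that[of p q])
    show "sme_less (zero_ext (\<Phi> p)) \<beta>"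
      by (rule sme_less_PtI[OF jP]) (use p c Cut in auto)
    show "sme_less \<beta> (zero_ext (\<Phi> q))"
      by (rule sme_less_PtI[OF jP]) (use q c Cut in auto)
  qed (use below p q c in auto)
qed

text \<open>If \<open>k\<close> is a point, a hull element is interpolated between the two
  coordinates. If \<open>k\<close> is \<open>Cut R\<close>, hull elements with the common
  coordinates on \<open>R\<close> have value 0 at \<open>k\<close> and lie between opposite signs;
  if one of the two values is itself 0, \<open>beyond\<close> selects a hull element on the right
  side of that one.\<close>

lemma separate_less:
  assumes \<beta>: "cut_element S \<beta>" and \<beta>': "cut_element S' \<beta>'"
    and k: "k \<in> prin_cuts" "\<beta> k < \<beta>' k"
    and eq: "\<And>l. l \<in> prin_cuts \<Longrightarrow> cut_less prin_less l k \<Longrightarrow> \<beta> l = \<beta>' l"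
  obtains q where "sme_less \<beta> (zero_ext (\<Phi> q))" "sme_less (zero_ext (\<Phi> q)) \<beta>'"
proof (cases k)
  case ki: (Pt i)
  then have i: "i \<in> Prin" using k(1) unfolding cut_indices_def by auto
  have eqPt: "\<beta> (Pt j) = \<beta>' (Pt j)" if "j \<in> Prin" "prin_less j i" for j
    using eq[of "Pt j"] that ki unfolding cut_indices_def by simp
  have eqCut: "\<beta> (Cut R) = \<beta>' (Cut R)" if "R \<in> Init Prin prin_less" "i \<notin> R" for R
    using eq[of "Cut R"] that ki unfolding cut_indices_def by simp
  \<comment> \<open>The element that is nonzero at \<open>i\<close> has \<open>i\<close> in its
    segment, so its coordinates before \<open>i\<close> come from the hull; the other element shares
    them.\<close>
  have "\<beta> k \<noteq> 0 \<or> \<beta>' k \<noteq> 0" using k(2) by auto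
  then have "i \<in> S \<or> i \<in> S'"
    using cut_elementD(3)[OF \<beta>] cut_elementD(3)[OF \<beta>'] ki by blast
  then obtain c where c: "\<And>j. j \<in> Prin \<Longrightarrow> prin_less j i \<Longrightarrow> \<beta> (Pt j) = \<Phi> c j"
    and Cut: "\<And>R. R \<in> Init Prin prin_less \<Longrightarrow> i \<notin> R \<Longrightarrow> \<beta> (Cut R) = 0"
  proof
    assume iS: "i \<in> S"
    obtain c where "\<And>j. j \<in> Prin \<Longrightarrow> prin_less j i \<Longrightarrow> \<beta> (Pt j) = \<Phi> c j"
      using cut_element_below[OF \<beta> iS] by blast
    then show thesis using that[of c] cut_elementD(5)[OF \<beta>] iS by blast
  next
    assume iS': "i \<in> S'"
    obtain c where "\<And>j. j \<in> Prin \<Longrightarrow> prin_less j i \<Longrightarrow> \<beta>' (Pt j) = \<Phi> c j"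
      using cut_element_below[OF \<beta>' iS'] by blast
    moreover have "\<beta>' (Cut R) = 0" if "i \<notin> R" for R
      using cut_elementD(5)[OF \<beta>'] that iS' by blast
    ultimately show thesis using that[of c] eqPt eqCut by auto
  qed
  obtain q where q: "\<And>j. j \<in> Prin \<Longrightarrow> prin_less j i \<Longrightarrow> \<Phi> q j = \<Phi> c j" "\<beta> k < \<Phi> q i" "\<Phi> q i < \<beta>' k"
    using interpolate[OF i k(2)] by blast
  show thesis
  proof (rule that[of q])
    show "sme_less \<beta> (zero_ext (\<Phi> q))"
      by (rule sme_less_PtI[OF i]) (use q c Cut ki in auto)
    show "sme_less (zero_ext (\<Phi> q)) \<beta>'"
      by (rule sme_less_PtI[OF i]) (use q c Cut ki eqPt eqCut in auto)
  qed
next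
  case kR: (Cut R)
  then have R: "R \<in> Init Prin prin_less" using k(1) unfolding cut_indices_def by auto
  then have "R \<subseteq> Prin" unfolding Init_def by blast
  have eqPt: "\<beta> (Pt j) = \<beta>' (Pt j)" if "j \<in> R" for j
    using eq[of "Pt j"] that kR \<open>R \<subseteq> Prin\<close> unfolding cut_indices_def by auto
  have eqCut: "\<beta> (Cut T) = \<beta>' (Cut T)" if "T \<in> Init Prin prin_less" "T \<subset> R" for T
    using eq[of "Cut T"] that kR unfolding cut_indices_def by simp
  have comm_eq: "comm_on R \<beta> \<longleftrightarrow> comm_on R \<beta>'"
    using eqPt unfolding comm_on_def by auto
  \<comment> \<open>A nonzero value at \<open>Cut R\<close> forces \<open>R\<close> to be the
    segment of \<alpha>, and only a commensurable segment carries such a value.\<close>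
  have comm_nz: "comm_on R \<alpha>" "\<alpha> (Cut R) \<in> {1, -1}" "\<And>T. T \<noteq> R \<Longrightarrow> \<alpha> (Cut T) = 0"
    if \<alpha>: "cut_element U \<alpha>" "\<alpha> k \<noteq> 0" for \<alpha> U
  proof -
    have "R = U" using cut_elementD(5)[OF \<alpha>(1)] \<alpha>(2) kR by auto
    then show "comm_on R \<alpha>" "\<alpha> (Cut R) \<in> {1, -1}" "\<And>T. T \<noteq> R \<Longrightarrow> \<alpha> (Cut T) = 0"
      using cut_elementD(5,6,7)[OF \<alpha>(1)] \<alpha>(2) kR by blast+
  qed
  have "\<beta> k \<noteq> 0 \<or> \<beta>' k \<noteq> 0" using k(2) by auto
  then have comm: "comm_on R \<beta>" "comm_on R \<beta>'"
    and Cut: "\<And>T. T \<in> Init Prin prin_less \<Longrightarrow> T \<subset> R \<Longrightarrow> \<beta> (Cut T) = 0 \<and> \<beta>' (Cut T) = 0"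
    using comm_nz[OF \<beta>] comm_nz[OF \<beta>'] comm_eq eqCut by (metis psubset_eq)+
  have signs: "\<beta> k \<in> {0, 1, -1}" "\<beta>' k \<in> {0, 1, -1}"
    using comm_nz(2)[OF \<beta>] comm_nz(2)[OF \<beta>'] kR by blast+
  have above: "sme_less \<beta> (zero_ext (\<Phi> q))"
    if "\<beta> k < 0" "\<And>i. i \<in> R \<Longrightarrow> \<Phi> q i = \<beta> (Pt i)" for q
    by (rule sme_less_CutI[OF R]) (use that kR Cut in auto)
  have below: "sme_less (zero_ext (\<Phi> q)) \<beta>'"
    if "\<beta>' k > 0" "\<And>i. i \<in> R \<Longrightarrow> \<Phi> q i = \<beta>' (Pt i)" for q
    by (rule sme_less_CutI[OF R]) (use that kR Cut in auto)
  consider "\<beta> k < 0" "\<beta>' k > 0" | "\<beta> k = 0" "\<beta>' k > 0" | "\<beta> k < 0" "\<beta>' k = 0"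
    using signs k(2) by auto
  then show thesis
  proof cases
    case 1
    obtain c where "\<And>i. i \<in> R \<Longrightarrow> \<beta> (Pt i) = \<Phi> c i"
      using comm(1) unfolding comm_on_def by blast
    then show thesis using that[of c] above[OF 1(1)] below[OF 1(2)] eqPt by simp
  next
    case 2
    have "\<beta> (Cut T) = 0" if "T \<in> Init Prin prin_less" "T \<subseteq> R" for T
      using Cut[OF that(1)] that(2) 2(1) kR by (cases "T = R") auto
    then obtain q where "\<And>i. i \<in> R \<Longrightarrow> \<Phi> q i = \<beta> (Pt i)" "sme_less \<beta> (zero_ext (\<Phi> q))"
      using beyond[OF \<beta> R comm(1)] by metis
    then show thesis using that[of q] below[OF 2(2)] eqPt by simp
  next
    case 3
    have "\<beta>' (Cut T) = 0" if "T \<in> Init Prin prin_less" "T \<subseteq> R" for T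
      using Cut[OF that(1)] that(2) 3(2) kR by (cases "T = R") auto
    then obtain q where "\<And>i. i \<in> R \<Longrightarrow> \<Phi> q i = \<beta>' (Pt i)" "sme_less (zero_ext (\<Phi> q)) \<beta>'"
      using beyond[OF \<beta>' R comm(2)] by metis
    then show thesis using that[of q] above[OF 3(1)] eqPt by simp
  qed
qed

lemma separate:
  assumes "cut_element S \<beta>" "cut_element S' \<beta>'" "\<beta> \<noteq> \<beta>'"
  obtains q where "sme_less \<beta> (zero_ext (\<Phi> q)) \<and> sme_less (zero_ext (\<Phi> q)) \<beta>' \<or>
    sme_less \<beta>' (zero_ext (\<Phi> q)) \<and> sme_less (zero_ext (\<Phi> q)) \<beta>"
proof -
  \<comment> \<open>Both functions vanish outside \<open>prin_cuts\<close>, so being distinct they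
    differ at an index inside it.\<close>
  have off: "\<alpha> l = 0" if "cut_element U \<alpha>" "l \<notin> prin_cuts" for U \<alpha> l
  proof (cases l)
    case (Pt i)
    then have "i \<notin> U"
      using that cut_elementD(1)[OF that(1)] unfolding cut_indices_def Init_def by blast
    then show ?thesis using cut_elementD(3)[OF that(1)] Pt by simp
  next
    case (Cut T)
    then have "T \<noteq> U"
      using that cut_elementD(1)[OF that(1)] unfolding cut_indices_def by blast
    then show ?thesis using cut_elementD(5)[OF that(1)] Cut by simp
  qed
  obtain l where l: "l \<in> prin_cuts" "\<beta> l \<noteq> \<beta>' l"
    using assms(3) off[OF assms(1)] off[OF assms(2)] by (metis ext)
  obtain k where k: "k \<in> prin_cuts" "\<beta> k \<noteq> \<beta>' k"
    "\<And>l. l \<in> prin_cuts \<Longrightarrow> cut_less prin_less l k \<Longrightarrow> \<beta> l = \<beta>' l"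
    using ex_first_difference[OF totalp_on_prin_cuts transp_on_prin_cuts
        wfp_on_cut_element[OF assms(1)] wfp_on_cut_element[OF assms(2)] l] by blast
  then consider "\<beta> k < \<beta>' k" | "\<beta>' k < \<beta> k" by linarith
  then show thesis
  proof cases
    case 1
    then show thesis using separate_less[OF assms(1,2) k(1) 1] k(3) that by metis
  next
    case 2
    then show thesis using separate_less[OF assms(2,1) k(1) 2] k(3) that by metis
  qed
qed

text \<open>By \<open>side\<close>, the first deviation from \<open>b\<close> on \<open>S\<close>
  decides to which side of the cut a hull element belongs; by \<open>same\<close>, the elements
  without deviation all lie on one side. Hence a suitable value at \<open>Cut S\<close> is all that
  must be added to \<open>b\<close>.\<close>

lemma realize_cut:
  assumes disj: "L \<inter> U = {}"
    and S: "S \<in> Init Prin prin_less" and off: "\<And>i. i \<notin> S \<Longrightarrow> b i = 0"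
    and wf: "wfp_on {i \<in> Prin. b i \<noteq> 0} prin_less"
    and comm: "\<And>R. R \<in> Init Prin prin_less \<Longrightarrow> R \<subset> S \<Longrightarrow> comm_on R (zero_ext b)"
    and side: "\<And>q i. i \<in> S \<Longrightarrow> (\<And>j. j \<in> Prin \<Longrightarrow> prin_less j i \<Longrightarrow> \<Phi> q j = b j) \<Longrightarrow>
      (\<Phi> q i < b i \<longrightarrow> q \<in> L) \<and> (b i < \<Phi> q i \<longrightarrow> q \<in> U)"
    and same: "(\<forall>q. (\<forall>i\<in>S. \<Phi> q i = b i) \<longrightarrow> q \<in> L) \<or> (\<forall>q. (\<forall>i\<in>S. \<Phi> q i = b i) \<longrightarrow> q \<in> U)"
  obtains \<beta> where "cut_element S \<beta>"
    "\<And>q. q \<in> L \<Longrightarrow> sme_less (zero_ext (\<Phi> q)) \<beta>" "\<And>q. q \<in> U \<Longrightarrow> sme_less \<beta> (zero_ext (\<Phi> q))"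
proof -
  \<comment> \<open>The value 0 is for the case that no hull element agrees with \<open>b\<close> on
    \<open>S\<close>. Otherwise \<beta> must lie above the agreeing elements if they belong to
    \<open>L\<close>, and below them if they belong to \<open>U\<close>.\<close>
  define r :: real where "r = (if \<not> comm_on S (zero_ext b) then 0
    else if \<forall>q. (\<forall>i\<in>S. \<Phi> q i = b i) \<longrightarrow> q \<in> L then 1 else -1)"
  define \<beta> where "\<beta> = (zero_ext b)(Cut S := r)"
  have Pt: "\<beta> (Pt i) = b i" and Cut: "\<beta> (Cut R) = (if R = S then r else 0)" for i R
    by (auto simp: \<beta>_def)
  have comm_eq: "comm_on R \<beta> \<longleftrightarrow> comm_on R (zero_ext b)" for R
    unfolding comm_on_def by (simp add: Pt)
  have "cut_element S \<beta>"
    unfolding cut_element_def comm_eq Pt using S wf off comm by (auto simp: Cut r_def)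
  have SP: "S \<subseteq> Prin" using S unfolding Init_def by blast
  have first: "\<exists>i\<in>S. \<Phi> q i \<noteq> b i \<and> (\<forall>j\<in>Prin. prin_less j i \<longrightarrow> \<Phi> q j = b j)"
    if ne: "\<not> (\<forall>i\<in>S. \<Phi> q i = b i)" for q
  proof -
    obtain l where l: "l \<in> S" "\<Phi> q l \<noteq> b l" using ne by blast
    then have "l \<in> Prin" using SP by blast
    obtain k where k: "k \<in> Prin" "\<Phi> q k \<noteq> b k" "\<And>j. j \<in> Prin \<Longrightarrow> prin_less j k \<Longrightarrow> \<Phi> q j = b j"
      using ex_first_difference[OF totalp_on_prin_less _ wf_support wf \<open>l \<in> Prin\<close> l(2)]
        prin_less_trans by (metis transp_onI)
    have "k \<in> S"
    proof (rule ccontr)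
      assume "k \<notin> S"
      then have "prin_less l k" using Init_not_mem[OF S l(1) k(1)] by blast
      then show False using k(3) l \<open>l \<in> Prin\<close> by blast
    qed
    then show ?thesis using k by blast
  qed
  show thesis
  proof (rule that[OF \<open>cut_element S \<beta>\<close>])
    fix q assume q: "q \<in> L"
    show "sme_less (zero_ext (\<Phi> q)) \<beta>"
    proof (cases "\<forall>i\<in>S. \<Phi> q i = b i")
      case True
      then have "comm_on S (zero_ext b)" unfolding comm_on_def by (intro exI[of _ q]) auto
      moreover have "\<forall>q. (\<forall>i\<in>S. \<Phi> q i = b i) \<longrightarrow> q \<in> L"
        using same True q disj by blast
      ultimately have "r = 1" unfolding r_def by simp
      then show ?thesis
        by (intro sme_less_CutI[OF S]) (use True in \<open>auto simp: Pt Cut\<close>)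
    next
      case False
      obtain i where i: "i \<in> S" "\<Phi> q i \<noteq> b i" "\<forall>j\<in>Prin. prin_less j i \<longrightarrow> \<Phi> q j = b j"
        using first[OF False] by blast
      then have "\<Phi> q i < b i" using side[of i q] q disj by force
      then show ?thesis
        using i SP by (intro sme_less_PtI[of i]) (auto simp: Pt Cut)
    qed
  next
    fix q assume q: "q \<in> U"
    show "sme_less \<beta> (zero_ext (\<Phi> q))"
    proof (cases "\<forall>i\<in>S. \<Phi> q i = b i")
      case True
      then have "comm_on S (zero_ext b)" unfolding comm_on_def by (intro exI[of _ q]) auto
      moreover have "\<not> (\<forall>q. (\<forall>i\<in>S. \<Phi> q i = b i) \<longrightarrow> q \<in> L)"
        using True q disj by blast
      ultimately have "r = -1" unfolding r_def by simp
      then show ?thesis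
        by (intro sme_less_CutI[OF S]) (use True in \<open>auto simp: Pt Cut\<close>)
    next
      case False
      obtain i where i: "i \<in> S" "\<Phi> q i \<noteq> b i" "\<forall>j\<in>Prin. prin_less j i \<longrightarrow> \<Phi> q j = b j"
        using first[OF False] by blast
      then have "b i < \<Phi> q i" using side[of i q] q disj by force
      then show ?thesis
        using i SP by (intro sme_less_PtI[of i]) (auto simp: Pt Cut)
    qed
  qed
qed

subsection \<open>Existence: filling a cut\<close>

text \<open>The larger of \<open>a\<close> and \<open>a'\<close> is in \<open>L\<close>, hence below
  \<open>b\<close> and below \<open>b'\<close>; by \<open>sandwich\<close> it has on
  \<open>S\<close> the coordinates of \<open>a\<close> and also those of \<open>a'\<close>.\<close>

lemma agree_on_Init:
  assumes less: "\<And>a b. a \<in> L \<Longrightarrow> b \<in> U \<Longrightarrow> a < b"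
    and "S \<in> Init Prin prin_less" "a \<in> L" "b \<in> U" "a' \<in> L" "b' \<in> U"
    and "\<And>i. i \<in> S \<Longrightarrow> \<Phi> a i = \<Phi> b i" "\<And>i. i \<in> S \<Longrightarrow> \<Phi> a' i = \<Phi> b' i" "i \<in> S"
  shows "\<Phi> a i = \<Phi> a' i"
proof -
  have m: "max a a' \<in> L" using assms(3,5) by (simp add: max_def)
  have "\<Phi> (max a a') i = \<Phi> a i"
    using sandwich[of a "max a a'" b S i] less_imp_le[OF less[OF m assms(4)]] assms(2,7,9) by simp
  moreover have "\<Phi> (max a a') i = \<Phi> a' i"
    using sandwich[of a' "max a a'" b' S i] less_imp_le[OF less[OF m assms(6)]] assms(2,8,9) by simp
  ultimately show ?thesis by simp
qed

text \<open>\<open>T\<close> consists of the indices up to which some element of \<open>L\<close> agrees with some element of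
  \<open>U\<close>; there the coordinates of the cut are forced. If the elements extending these coordinates
  lie on both sides, the complement of \<open>T\<close> has a least index, and one more coordinate,
  a supremum, decides.\<close>

lemma fill_cut:
  assumes LU: "L \<union> U = UNIV" and less: "\<And>a b. a \<in> L \<Longrightarrow> b \<in> U \<Longrightarrow> a < b"
  obtains S \<beta> where "cut_element S \<beta>"
    "\<And>q. q \<in> L \<Longrightarrow> sme_less (zero_ext (\<Phi> q)) \<beta>" "\<And>q. q \<in> U \<Longrightarrow> sme_less \<beta> (zero_ext (\<Phi> q))"
proof -
  have disj: "L \<inter> U = {}" using less by blast
  have down: "q \<in> L" if "q < a" "a \<in> L" for q a
    using that LU less[of a q] by (metis UNIV_I UnE order_less_asym)
  have up: "q \<in> U" if "b < q" "b \<in> U" for q b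
    using that LU less[of q b] by (metis UNIV_I UnE order_less_asym)
  \<comment> \<open>The segment includes \<open>i\<close> itself: membership in \<open>T\<close> is
    to force the coordinate at \<open>i\<close>, not only those before it.\<close>
  define upto where "upto i = insert i {j \<in> Prin. prin_less j i}" for i :: "'q set"
  have upto_Init: "upto i \<in> Init Prin prin_less" if "i \<in> Prin" for i
    using that prin_less_trans unfolding upto_def Init_def by blast
  have upto_mono: "upto j \<subseteq> upto i" if "j \<in> upto i" for i j
    using that prin_less_trans unfolding upto_def by blast
  define P where "P a b i \<longleftrightarrow> a \<in> L \<and> b \<in> U \<and> (\<forall>j\<in>upto i. \<Phi> a j = \<Phi> b j)" for a b i
  have P_down: "P a b j" if "P a b i" "j \<in> upto i" for a b i j
    using that upto_mono[OF that(2)] unfolding P_def by blast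
  define T where "T = {i \<in> Prin. \<exists>a b. P a b i}"
  have TP: "T \<subseteq> Prin" unfolding T_def by blast
  have T: "T \<in> Init Prin prin_less"
    using P_down unfolding T_def Init_def upto_def by blast
  have "\<forall>i\<in>T. \<exists>a b. P a b i"
    unfolding T_def by blast
  then obtain A B where AB: "\<And>i. i \<in> T \<Longrightarrow> P (A i) (B i) i" by metis
  \<comment> \<open>The witnesses are chosen independently for each index. By
    \<open>agree_on_Init\<close> the value does not depend on the choice, so \<open>t\<close>
    follows every witness pair up to its index.\<close>
  define t where "t i = (if i \<in> T then \<Phi> (A i) i else 0)" for i
  have t: "t j = \<Phi> a j" if "P a b i" "i \<in> T" "j \<in> upto i" for a b i j
  proof -
    have "j \<in> Prin" using that(2,3) TP unfolding upto_def by blast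
    then have "j \<in> T" using P_down[OF that(1,3)] unfolding T_def by blast
    have "\<Phi> (A j) j = \<Phi> a j"
      by (rule agree_on_Init[where b = "B j" and b' = b, OF less upto_Init[OF \<open>j \<in> Prin\<close>]])
        (use AB[OF \<open>j \<in> T\<close>] P_down[OF that(1,3)] in \<open>auto simp: P_def upto_def\<close>)
    then show ?thesis using \<open>j \<in> T\<close> by (simp add: t_def)
  qed
  \<comment> \<open>Up to any index \<open>x\<close> of \<open>T\<close>, \<open>t\<close> coincides
    with the single hull element \<open>A x\<close>, so a least element of \<open>X\<close> can be
    found in the support of \<open>A x\<close>.\<close>
  have wf_t: "wfp_on {i \<in> Prin. t i \<noteq> 0} prin_less"
    unfolding wfp_on_iff_ex_minimal
  proof (intro allI impI)
    fix X assume X: "X \<subseteq> {i \<in> Prin. t i \<noteq> 0}" "X \<noteq> {}"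
    then obtain x where x: "x \<in> X" by blast
    then have "x \<in> T" using X(1) unfolding t_def by (auto split: if_splits)
    have "X \<inter> upto x \<subseteq> {i \<in> Prin. \<Phi> (A x) i \<noteq> 0}"
      using X(1) t[OF AB[OF \<open>x \<in> T\<close>] \<open>x \<in> T\<close>] by auto
    moreover have "X \<inter> upto x \<noteq> {}" using x unfolding upto_def by blast
    ultimately obtain z where z: "z \<in> X \<inter> upto x" "\<And>y. prin_less y z \<Longrightarrow> y \<notin> X \<inter> upto x"
      using wf_support[of "A x"] unfolding wfp_on_iff_ex_minimal by metis
    have "y \<notin> X" if "prin_less y z" for y
    proof
      assume "y \<in> X"
      then have "y \<in> upto z" using that X(1) unfolding upto_def by blast
      then show False using z upto_mono[of z x] that \<open>y \<in> X\<close> by blast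
    qed
    then show "\<exists>z\<in>X. \<forall>y. prin_less y z \<longrightarrow> y \<notin> X" using z(1) by blast
  qed
  \<comment> \<open>\<open>A i\<close> and \<open>B i\<close> both have the coordinates
    \<open>t\<close> up to \<open>i\<close>, so an element first deviating at \<open>i\<close> is
    below \<open>A i\<close> or above \<open>B i\<close>.\<close>
  have side: "(\<Phi> q i < t i \<longrightarrow> q \<in> L) \<and> (t i < \<Phi> q i \<longrightarrow> q \<in> U)"
    if i: "i \<in> T" "\<And>j. j \<in> Prin \<Longrightarrow> prin_less j i \<Longrightarrow> \<Phi> q j = t j" for q i
  proof -
    note P = AB[OF i(1)]
    have a: "\<Phi> (A i) j = t j" if "j \<in> upto i" for j
      using t[OF P i(1) that] by simp
    then have b: "\<Phi> (B i) j = t j" if "j \<in> upto i" for j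
      using that P unfolding P_def by metis
    have "q < A i" if "\<Phi> q i < t i"
      by (rule lessI[of i]) (use i TP a that in \<open>auto simp: upto_def\<close>)
    moreover have "B i < q" if "t i < \<Phi> q i"
      by (rule lessI[of i]) (use i TP b that in \<open>auto simp: upto_def\<close>)
    ultimately show ?thesis using down up P unfolding P_def by blast
  qed
  have comm: "comm_on R (zero_ext t)" if R: "R \<in> Init Prin prin_less" "R \<subset> T" for R
  proof -
    obtain i where i: "i \<in> T" "i \<notin> R" using R(2) by blast
    have "j \<in> upto i" if "j \<in> R" for j
      using Init_not_mem[OF R(1) that _ i(2)] R i TP that unfolding upto_def by blast
    then show ?thesis
      unfolding comm_on_def using t[OF AB[OF i(1)] i(1)] by auto
  qed
  show thesis
  proof (cases "(\<forall>q. (\<forall>i\<in>T. \<Phi> q i = t i) \<longrightarrow> q \<in> L) \<or> (\<forall>q. (\<forall>i\<in>T. \<Phi> q i = t i) \<longrightarrow> q \<in> U)")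
    case True
    show thesis
      by (rule realize_cut[OF disj T _ wf_t comm side True])
        (use that in \<open>auto simp: t_def\<close>)
  next
    case False
    then obtain a0 b0 where ab: "a0 \<in> L" "b0 \<in> U" "\<And>i. i \<in> T \<Longrightarrow> \<Phi> a0 i = t i"
      "\<And>i. i \<in> T \<Longrightarrow> \<Phi> b0 i = t i"
      using LU by blast
    \<comment> \<open>This \<open>k\<close> is the least index outside \<open>T\<close>: the
      elements \<open>a0\<close> and \<open>b0\<close> from opposite sides agree at all earlier
      indices, which puts these into \<open>T\<close>.\<close>
    obtain k where k: "k \<in> Prin" "\<Phi> a0 k < \<Phi> b0 k"
      "\<And>j. j \<in> Prin \<Longrightarrow> prin_less j k \<Longrightarrow> \<Phi> a0 j = \<Phi> b0 j"
      using lessE[OF less[OF ab(1,2)]] by blast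
    have "k \<notin> T" using k(2) ab(3,4) by fastforce
    have T_eq: "T = {j \<in> Prin. prin_less j k}"
    proof (intro equalityI subsetI)
      fix j assume "j \<in> T"
      then show "j \<in> {j \<in> Prin. prin_less j k}"
        using Init_not_mem[OF T _ k(1) \<open>k \<notin> T\<close>] TP by blast
    next
      fix j assume j: "j \<in> {j \<in> Prin. prin_less j k}"
      then have "\<Phi> a0 i = \<Phi> b0 i" if "i \<in> upto j" for i
        using k(3) that prin_less_trans unfolding upto_def by blast
      then show "j \<in> T" using j ab(1,2) unfolding T_def P_def by blast
    qed
    \<comment> \<open>Among the elements extending \<open>t\<close>, the coordinates at
      \<open>k\<close> inherit a cut in the reals; its supremum is the additional
      coordinate.\<close>
    define X where "X = {\<Phi> a k | a. a \<in> L \<and> (\<forall>i\<in>T. \<Phi> a i = t i)}"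
    have X_le: "x \<le> \<Phi> b k" if "x \<in> X" "b \<in> U" "\<And>i. i \<in> T \<Longrightarrow> \<Phi> b i = t i" for x b
    proof (rule ccontr)
      assume *: "\<not> x \<le> \<Phi> b k"
      obtain a where a: "x = \<Phi> a k" "a \<in> L" "\<And>i. i \<in> T \<Longrightarrow> \<Phi> a i = t i"
        using \<open>x \<in> X\<close> unfolding X_def by blast
      have "b < a"
        by (rule lessI[OF k(1)]) (use * a that(3) T_eq in auto)
      then show False using less[OF a(2) that(2)] by simp
    qed
    have "X \<noteq> {}" using ab unfolding X_def by blast
    have bdd: "bdd_above X" using X_le[OF _ ab(2) ab(4)] unfolding bdd_above_def by blast
    define r where "r = Sup X"
    let ?b = "t(k := r)"
    have off: "?b i = 0" if "i \<notin> insert k T" for i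
      using that by (simp add: t_def)
    have S: "insert k T \<in> Init Prin prin_less"
      using upto_Init[OF k(1)] unfolding upto_def T_eq .
    have wf: "wfp_on {i \<in> Prin. ?b i \<noteq> 0} prin_less"
    proof (rule wfp_on_subset)
      show "wfp_on ({i \<in> Prin. t i \<noteq> 0} \<union> {k}) prin_less"
      proof (rule wfp_on_Un[OF _ _ wf_t])
        show "totalp_on ({i \<in> Prin. t i \<noteq> 0} \<union> {k}) prin_less"
          by (rule totalp_on_subset[OF totalp_on_prin_less]) (use k(1) in auto)
        show "transp_on ({i \<in> Prin. t i \<noteq> 0} \<union> {k}) prin_less"
          by (rule transp_onI) (rule prin_less_trans)
        show "wfp_on {k} prin_less"
          unfolding wfp_on_iff_ex_minimal by (auto dest!: subset_singletonD)
      qed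
    qed auto
    \<comment> \<open>A proper initial segment of \<open>insert k T\<close> omits \<open>k\<close>,
      since with \<open>k\<close> it would contain all of \<open>T\<close>; and on \<open>T\<close>
      the element \<open>a0\<close> has the required coordinates.\<close>
    have comm': "comm_on R (zero_ext ?b)" if R: "R \<in> Init Prin prin_less" "R \<subset> insert k T" for R
    proof -
      have "R \<subseteq> T"
      proof (cases "k \<in> R")
        case True
        then have "T \<subseteq> R" using R(1) unfolding T_eq Init_def by blast
        then show ?thesis using True R(2) by blast
      qed (use R(2) in blast)
      then show ?thesis
        unfolding comm_on_def using ab(3) \<open>k \<notin> T\<close> by (intro exI[of _ a0]) auto
    qed
    have side': "(\<Phi> q i < ?b i \<longrightarrow> q \<in> L) \<and> (?b i < \<Phi> q i \<longrightarrow> q \<in> U)"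
      if i: "i \<in> insert k T" "\<And>j. j \<in> Prin \<Longrightarrow> prin_less j i \<Longrightarrow> \<Phi> q j = ?b j" for q i
    proof (cases "i = k")
      case False
      then have "i \<in> T" using i(1) by blast
      have "\<Phi> q j = t j" if "j \<in> Prin" "prin_less j i" for j
      proof -
        have "j \<in> T" using T \<open>i \<in> T\<close> that unfolding Init_def by blast
        then show ?thesis using i(2)[OF that] \<open>k \<notin> T\<close> by (auto split: if_splits)
      qed
      then show ?thesis using side[OF \<open>i \<in> T\<close>] False by simp
    next
      case True
      have q: "\<Phi> q j = t j" if "j \<in> T" for j
        using i(2)[of j] that \<open>k \<notin> T\<close> True by (auto simp: T_eq)
      have "q \<in> L" if lt: "\<Phi> q k < r"
      proof -
        obtain x where "x \<in> X" "\<Phi> q k < x"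
          using less_cSupE[of "\<Phi> q k" X] lt \<open>X \<noteq> {}\<close> unfolding r_def by blast
        then obtain a where a: "\<Phi> q k < \<Phi> a k" "a \<in> L" "\<And>i. i \<in> T \<Longrightarrow> \<Phi> a i = t i"
          unfolding X_def by blast
        have "q < a" by (rule lessI[OF k(1) a(1)]) (use q a(3) T_eq in auto)
        then show ?thesis using down a(2) by blast
      qed
      moreover have "q \<in> U" if "r < \<Phi> q k"
      proof (rule ccontr)
        assume "q \<notin> U"
        then have "q \<in> L" using LU by blast
        then have "\<Phi> q k \<in> X" using q unfolding X_def by blast
        then show False using cSup_upper[OF _ bdd] that unfolding r_def by fastforce
      qed
      ultimately show ?thesis using True by simp
    qed
    \<comment> \<open>Elements of \<open>L\<close> and \<open>U\<close> agreeing up to and including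
      \<open>k\<close> would put \<open>k\<close> into \<open>T\<close>.\<close>
    have same: "(\<forall>q. (\<forall>i\<in>insert k T. \<Phi> q i = ?b i) \<longrightarrow> q \<in> L) \<or>
      (\<forall>q. (\<forall>i\<in>insert k T. \<Phi> q i = ?b i) \<longrightarrow> q \<in> U)"
    proof (rule ccontr)
      assume "\<not> ?thesis"
      then obtain a b where "a \<in> L" "b \<in> U" "\<forall>i\<in>insert k T. \<Phi> a i = ?b i" "\<forall>i\<in>insert k T. \<Phi> b i = ?b i"
        using LU by blast
      then have "P a b k"
        unfolding P_def upto_def T_eq[symmetric] by auto
      then show False using \<open>k \<notin> T\<close> k(1) unfolding T_def by blast
    qed
    show thesis
      by (rule realize_cut[OF disj S off wf comm' side' same]) (use that in auto)
  qed
qed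

lemma sme_less_zero_ext:
  assumes "x < y"
  shows "sme_less (zero_ext (\<Phi> x)) (zero_ext (\<Phi> y))"
proof -
  obtain k where "k \<in> Prin" "\<Phi> x k < \<Phi> y k"
    "\<And>j. j \<in> Prin \<Longrightarrow> prin_less j k \<Longrightarrow> \<Phi> x j = \<Phi> y j"
    using lessE[OF assms] by blast
  then show ?thesis by (intro sme_less_PtI[of k]) auto
qed

lemma zero_ext_add: "zero_ext (\<Phi> (x + y)) = zero_ext (\<Phi> x) + zero_ext (\<Phi> y)"
proof
  show "zero_ext (\<Phi> (x + y)) k = (zero_ext (\<Phi> x) + zero_ext (\<Phi> y)) k" for k
    by (cases k) (simp_all add: add)
qed

end

section \<open>Additive maps and adjunction of one generator\<close>

lemma sme_less_affine:
  assumes "n > 0"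
  shows "sme_less (nsmul n f + h) (nsmul n g + h) \<longleftrightarrow> sme_less f g"
proof -
  have nsmul_apply: "nsmul n f k = real n * f k" for n and f :: "'a set cut_index \<Rightarrow> real" and k
  proof (induction n)
    case 0
    then show ?case by (simp add: nsmul_def)
  qed (simp add: nsmul_Suc algebra_simps)
  have "nsmul n f + h = (\<lambda>k. real n * f k + h k)" for f :: "'a set cut_index \<Rightarrow> real"
    by (simp add: fun_eq_iff nsmul_apply)
  then show ?thesis
    using assms by (simp add: sme_less_def lex_less_translate lex_less_scale)
qed

lemma sme_less_irrefl: "\<not> sme_less f f"
  by (simp add: sme_less_def lex_less_def)

lemma (in hull_embedding) sme_less_asym:
  "sme_less f g \<Longrightarrow> \<not> sme_less g (f :: 'q set cut_index \<Rightarrow> real)"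
  unfolding sme_less_def using lex_less_asym[OF totalp_on_prin_cuts] by blast

lemma additive_nsmul:
  fixes f :: "'a::ab_group_add \<Rightarrow> 'b::ab_group_add"
  assumes "\<And>x y. x \<in> C \<Longrightarrow> y \<in> C \<Longrightarrow> f (x + y) = f x + f y" "subgroup C (add_grp UNIV)" "x \<in> C"
  shows "nsmul n x \<in> C \<and> f (nsmul n x) = nsmul n (f x)"
proof (induction n)
  case 0
  have "0 \<in> C" using assms(2) by (simp add: subgroup_add_grp_iff)
  then show ?case using assms(1)[of 0 0] by (simp add: nsmul_def)
next
  case (Suc n)
  then show ?case using assms unfolding subgroup_add_grp_iff by (simp add: nsmul_Suc)
qed

lemma generate_insert_decomp:
  fixes C :: "'a::ab_group_add set"
  assumes C: "subgroup C (add_grp UNIV)" and x: "x \<in> generate (add_grp UNIV) (insert \<gamma> C)"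
  shows "\<exists>\<xi>\<in>C. \<exists>m n. x = \<xi> + nsmul m \<gamma> - nsmul n \<gamma>"
proof -
  let ?X = "{\<xi> + nsmul m \<gamma> - nsmul n \<gamma> | \<xi> m n. \<xi> \<in> C}"
  have C0: "0 \<in> C" using C by (simp add: subgroup_add_grp_iff)
  have "subgroup ?X (add_grp UNIV)"
    unfolding subgroup_add_grp_iff
  proof (intro conjI ballI)
    show "0 \<in> ?X"
      using C0 by (intro CollectI exI[of _ 0]) simp
    show "x + y \<in> ?X" if xy: "x \<in> ?X" "y \<in> ?X" for x y
    proof -
      obtain \<xi> m n \<eta> k l where *: "x = \<xi> + nsmul m \<gamma> - nsmul n \<gamma>" "\<xi> \<in> C"
        "y = \<eta> + nsmul k \<gamma> - nsmul l \<gamma>" "\<eta> \<in> C"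
        using xy by blast
      have "x + y = (\<xi> + \<eta>) + nsmul (m + k) \<gamma> - nsmul (n + l) \<gamma>"
        unfolding *(1,3) by (simp add: nsmul_add_left algebra_simps)
      moreover have "\<xi> + \<eta> \<in> C"
        using C *(2,4) unfolding subgroup_add_grp_iff by blast
      ultimately show ?thesis by blast
    qed
    show "- x \<in> ?X" if x: "x \<in> ?X" for x
    proof -
      obtain \<xi> m n where *: "x = \<xi> + nsmul m \<gamma> - nsmul n \<gamma>" "\<xi> \<in> C"
        using x by blast
      have "- x = - \<xi> + nsmul n \<gamma> - nsmul m \<gamma>"
        unfolding *(1) by (simp add: algebra_simps)
      moreover have "- \<xi> \<in> C"
        using C *(2) unfolding subgroup_add_grp_iff by blast
      ultimately show ?thesis by blast
    qed
  qed
  moreover have "insert \<gamma> C \<subseteq> ?X"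
  proof (intro insert_subsetI subsetI)
    show "\<gamma> \<in> ?X"
      using C0 by (intro CollectI exI[of _ 0] exI[of _ "Suc 0"]) (simp add: nsmul_def)
    show "\<xi> \<in> ?X" if "\<xi> \<in> C" for \<xi>
      using that by (intro CollectI exI[of _ \<xi>] exI[of _ 0]) (simp add: nsmul_def)
  qed
  ultimately have "generate (add_grp UNIV) (insert \<gamma> C) \<subseteq> ?X"
    by (intro group.generate_subgroup_incl) auto
  then show ?thesis using x by blast
qed

text \<open>No positive multiple of \<gamma> lies in \<open>C\<close>, so the group is the direct
  sum of \<open>C\<close> and the infinite cyclic group generated by \<gamma>; the value at \<gamma>
  is therefore free.\<close>

lemma extend_additive:
  fixes F :: "'a::ab_group_add \<Rightarrow> 'b::ab_group_add"
  assumes C: "subgroup C (add_grp UNIV)"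
    and F: "\<And>x y. x \<in> C \<Longrightarrow> y \<in> C \<Longrightarrow> F (x + y) = F x + F y"
    and gen: "generate (add_grp UNIV) (insert \<gamma> C) = UNIV"
    and tf: "\<And>n. n > 0 \<Longrightarrow> nsmul n \<gamma> \<notin> C"
  obtains f where "\<And>x y. f (x + y) = f x + f y" "f \<gamma> = \<beta>" "\<And>\<xi>. \<xi> \<in> C \<Longrightarrow> f \<xi> = F \<xi>"
proof -
  note C' = C[unfolded subgroup_add_grp_iff]
  have decomp: "\<exists>\<xi> m n. \<xi> \<in> C \<and> x = \<xi> + nsmul m \<gamma> - nsmul n \<gamma>" for x
    using generate_insert_decomp[OF C, of x \<gamma>] gen by blast
  then obtain X M N where XMN: "\<And>x. X x \<in> C" "\<And>x. x = X x + nsmul (M x) \<gamma> - nsmul (N x) \<gamma>"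
    by metis
  define f where "f x = F (X x) + nsmul (M x) \<beta> - nsmul (N x) \<beta>" for x
  \<comment> \<open>Uniqueness of the decomposition. Under \<open>mn\<close> the two multiples of
    \<gamma> differ by a natural number \<open>d\<close>, and \<open>nsmul d \<gamma>\<close> in
    \<open>C\<close> forces \<open>d = 0\<close>.\<close>
  have le: "\<eta> = \<xi> \<and> m + l = k + n"
    if "\<xi> \<in> C" "\<eta> \<in> C" "\<xi> + nsmul m \<gamma> - nsmul n \<gamma> = \<eta> + nsmul k \<gamma> - nsmul l \<gamma>" and mn: "m + l \<le> k + n"
    for \<xi> \<eta> m n k l
  proof -
    obtain d where d: "k + n = d + (m + l)" using mn by (metis le_add_diff_inverse2)
    have "\<xi> + nsmul (m + l) \<gamma> = \<eta> + nsmul (k + n) \<gamma>"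
      using that(3) by (simp add: nsmul_add_left algebra_simps)
    then have "nsmul d \<gamma> = \<xi> + - \<eta>"
      unfolding d by (simp add: nsmul_add_left algebra_simps)
    then have "nsmul d \<gamma> \<in> C"
      using that(1,2) C' by metis
    then have "d = 0" using tf by auto
    then show ?thesis using d \<open>nsmul d \<gamma> = \<xi> + - \<eta>\<close> by (simp add: nsmul_def)
  qed
  have f: "f (\<xi> + nsmul m \<gamma> - nsmul n \<gamma>) = F \<xi> + nsmul m \<beta> - nsmul n \<beta>" if "\<xi> \<in> C" for \<xi> m n
  proof -
    let ?x = "\<xi> + nsmul m \<gamma> - nsmul n \<gamma>"
    have eq: "?x = X ?x + nsmul (M ?x) \<gamma> - nsmul (N ?x) \<gamma>" using XMN(2) .
    have "X ?x = \<xi> \<and> m + N ?x = M ?x + n"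
      using le[OF that XMN(1) eq] le[OF XMN(1) that eq[symmetric]] by (metis nat_le_linear)
    then have "X ?x = \<xi>" "nsmul m \<beta> + nsmul (N ?x) \<beta> = nsmul (M ?x) \<beta> + nsmul n \<beta>"
      by (simp_all flip: nsmul_add_left)
    then show ?thesis unfolding f_def[of ?x] by (simp add: algebra_simps)
  qed
  have "F 0 = 0" using F[of 0 0] C' by simp
  show thesis
  proof (rule that[of f])
    fix x y
    have "x + y = (X x + X y) + nsmul (M x + M y) \<gamma> - nsmul (N x + N y) \<gamma>"
      by (subst XMN(2)[of x], subst XMN(2)[of y]) (simp add: nsmul_add_left algebra_simps)
    moreover have "X x + X y \<in> C" using XMN(1) C' by blast
    ultimately have "f (x + y) = F (X x + X y) + nsmul (M x + M y) \<beta> - nsmul (N x + N y) \<beta>"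
      using f by metis
    also have "\<dots> = f x + f y"
      by (simp add: f_def F XMN(1) nsmul_add_left algebra_simps)
    finally show "f (x + y) = f x + f y" .
  next
    show "f \<gamma> = \<beta>"
      using f[of 0 "Suc 0" 0] C' \<open>F 0 = 0\<close> by (simp add: nsmul_def)
    show "f \<xi> = F \<xi>" if "\<xi> \<in> C" for \<xi>
      using f[OF that, of 0 0] by (simp add: nsmul_def)
  qed
qed

subsection \<open>Extensions generated by one element over a pure subgroup\<close>

text \<open>\<open>C\<close> plays the commensurable subgroup, and \<open>pure\<close> makes the
  quotient by it torsion-free. By \<open>\<kappa>_multiple\<close> each hull element is a fraction
  with numerator from \<open>C\<close>, which turns the position of \<gamma> relative to
  \<open>C\<close> into a cut of the hull.\<close>

locale monogenic_extension = hull_embedding \<Phi>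
  for \<Phi> :: "'q::linordered_ab_group_add \<Rightarrow> 'q set \<Rightarrow> real" +
  fixes C :: "'l::linordered_ab_group_add set" and \<kappa> :: "'l \<Rightarrow> 'q" and \<gamma> :: 'l
  assumes subgroup_C: "subgroup C (add_grp UNIV)"
    and pure: "n > 0 \<Longrightarrow> nsmul n \<xi> \<in> C \<Longrightarrow> \<xi> \<in> C"
    and generated: "generate (add_grp UNIV) (insert \<gamma> C) = UNIV"
    and \<kappa>_add: "\<xi> \<in> C \<Longrightarrow> \<eta> \<in> C \<Longrightarrow> \<kappa> (\<xi> + \<eta>) = \<kappa> \<xi> + \<kappa> \<eta>"
    and \<kappa>_mono: "\<xi> \<in> C \<Longrightarrow> \<eta> \<in> C \<Longrightarrow> \<xi> < \<eta> \<Longrightarrow> \<kappa> \<xi> < \<kappa> \<eta>"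
    and \<kappa>_multiple: "\<exists>n \<xi>. n > 0 \<and> \<xi> \<in> C \<and> nsmul n q = \<kappa> \<xi>"
begin

definition F :: "'l \<Rightarrow> 'q set cut_index \<Rightarrow> real"
  where "F = (\<lambda>\<xi>. zero_ext (\<Phi> (\<kappa> \<xi>)))"

definition realizes :: "('q set cut_index \<Rightarrow> real) \<Rightarrow> ('l \<Rightarrow> 'q set cut_index \<Rightarrow> real) \<Rightarrow> bool"
  where "realizes \<beta> f \<longleftrightarrow> (\<forall>x y. f (x + y) = f x + f y) \<and> (\<forall>x y. x < y \<longrightarrow> sme_less (f x) (f y)) \<and>
    f \<gamma> = \<beta> \<and> (\<forall>\<xi>\<in>C. f \<xi> = F \<xi>)"

lemma realizesD:
  assumes "realizes \<beta> f"
  shows "f (x + y) = f x + f y" "x < y \<Longrightarrow> sme_less (f x) (f y)" "f \<gamma> = \<beta>" "\<xi> \<in> C \<Longrightarrow> f \<xi> = F \<xi>"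
    "f (nsmul n x) = nsmul n (f x)"
  using assms additive_nsmul[of UNIV f x n] unfolding realizes_def
  by (auto simp: subgroup_add_grp_iff)

lemma realizes_inj:
  assumes "realizes \<beta> f" "f x = f y"
  shows "x = y"
  using realizesD(2)[OF assms(1), of x y] realizesD(2)[OF assms(1), of y x] assms(2) sme_less_irrefl
  by (cases x y rule: linorder_cases) auto

text \<open>Additivity and translation invariance of \<open>sme_less\<close> reduce monotonicity to
  positivity.\<close>

lemma realizesI:
  assumes add: "\<And>x y. f (x + y) = f x + f y" and pos: "\<And>x. 0 < x \<Longrightarrow> sme_less 0 (f x)"
    and "f \<gamma> = \<beta>" "\<And>\<xi>. \<xi> \<in> C \<Longrightarrow> f \<xi> = F \<xi>"
  shows "realizes \<beta> f"
proof -
  have "sme_less (f x) (f y)" if "x < y" for x y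
  proof -
    have "sme_less 0 (f (y - x))" using pos that by simp
    then show ?thesis
      using sme_less_affine[of "Suc 0" 0 "f x" "f (y - x)"] add[of "y - x" x] by simp
  qed
  then show ?thesis using assms unfolding realizes_def by blast
qed

text \<open>Surjectivity is automatic, as a homomorphism maps a generated subgroup onto the one
  generated by the image; injectivity and reflection of the order come from strict monotonicity,
  since \<open>sme_less\<close> is irreflexive and asymmetric.\<close>

lemma iso_iff_realizes:
  "f \<in> iso (add_grp UNIV) (add_grp (generate (add_grp UNIV) (insert \<beta> (F ` C)))) \<and>
    (\<forall>x y. x < y \<longleftrightarrow> sme_less (f x) (f y)) \<and> f \<gamma> = \<beta> \<and> (\<forall>\<xi>\<in>C. f \<xi> = F \<xi>) \<longleftrightarrow> realizes \<beta> f"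
proof
  assume "realizes \<beta> f"
  note f = realizesD[OF this]
  interpret group_hom "add_grp UNIV :: 'l monoid" "add_grp UNIV :: ('q set cut_index \<Rightarrow> real) monoid" f
    by (intro group_hom.intro group_hom_axioms.intro group_add_grp_UNIV) (auto simp: hom_def f(1))
  have "f ` insert \<gamma> C = insert \<beta> (F ` C)"
    using f(3,4) by auto
  then have range: "range f = generate (add_grp UNIV) (insert \<beta> (F ` C))"
    using generate_img[of "insert \<gamma> C"] generated by simp
  have "inj f"
    using realizes_inj[OF \<open>realizes \<beta> f\<close>] by (rule injI)
  then have "f \<in> iso (add_grp UNIV) (add_grp (generate (add_grp UNIV) (insert \<beta> (F ` C))))"
    unfolding iso_def hom_def bij_betw_def range[symmetric] by (auto simp: f(1))
  moreover have "x < y" if "sme_less (f x) (f y)" for x y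
    using that f(2)[of y x] sme_less_irrefl sme_less_asym by (cases x y rule: linorder_cases) auto
  ultimately show "f \<in> iso (add_grp UNIV) (add_grp (generate (add_grp UNIV) (insert \<beta> (F ` C)))) \<and>
    (\<forall>x y. x < y \<longleftrightarrow> sme_less (f x) (f y)) \<and> f \<gamma> = \<beta> \<and> (\<forall>\<xi>\<in>C. f \<xi> = F \<xi>)"
    using f(2,3,4) by blast
next
  assume *: "f \<in> iso (add_grp UNIV) (add_grp (generate (add_grp UNIV) (insert \<beta> (F ` C)))) \<and>
    (\<forall>x y. x < y \<longleftrightarrow> sme_less (f x) (f y)) \<and> f \<gamma> = \<beta> \<and> (\<forall>\<xi>\<in>C. f \<xi> = F \<xi>)"
  then have "f (x + y) = f x + f y" for x y
    by (auto simp: iso_def hom_def)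
  then show "realizes \<beta> f" using * unfolding realizes_def by blast
qed

lemma F_add: "\<xi> \<in> C \<Longrightarrow> \<eta> \<in> C \<Longrightarrow> F (\<xi> + \<eta>) = F \<xi> + F \<eta>"
  by (simp add: F_def \<kappa>_add zero_ext_add)

lemma C_closed: "0 \<in> C" "\<xi> \<in> C \<Longrightarrow> \<eta> \<in> C \<Longrightarrow> \<xi> + \<eta> \<in> C" "\<xi> \<in> C \<Longrightarrow> - \<xi> \<in> C" "\<xi> \<in> C \<Longrightarrow> nsmul n \<xi> \<in> C"
  using subgroup_C additive_nsmul[OF \<kappa>_add subgroup_C] unfolding subgroup_add_grp_iff by auto

lemma \<kappa>_nsmul: "\<xi> \<in> C \<Longrightarrow> \<kappa> (nsmul n \<xi>) = nsmul n (\<kappa> \<xi>)"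
  using additive_nsmul[OF \<kappa>_add subgroup_C] by blast

lemma zero_ext_nsmul: "zero_ext (\<Phi> (nsmul n q)) = nsmul n (zero_ext (\<Phi> q))"
  using additive_nsmul[of UNIV "\<lambda>q. zero_ext (\<Phi> q)" q n] zero_ext_add
  by (auto simp: subgroup_add_grp_iff)

lemma F_zero: "F 0 = 0"
  using F_add[of 0 0] C_closed(1) by simp

lemma F_uminus: "\<xi> \<in> C \<Longrightarrow> F (- \<xi>) = - F \<xi>"
  using F_add[of \<xi> "- \<xi>"] C_closed(3) F_zero by (simp add: eq_neg_iff_add_eq_0 add.commute)

lemma F_mono: "\<xi> \<in> C \<Longrightarrow> \<eta> \<in> C \<Longrightarrow> \<xi> < \<eta> \<Longrightarrow> sme_less (F \<xi>) (F \<eta>)"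
  unfolding F_def by (intro sme_less_zero_ext \<kappa>_mono)

text \<open>The lower half of the cut of \<gamma>. Here \<open>q\<close> is
  \<open>\<kappa> \<xi>\<close> divided by \<open>n\<close>, and clearing the denominator turns its
  comparison with \<gamma> into one that makes sense inside the extension.\<close>

definition Lower :: "'q set"
  where "Lower = {q. \<exists>n>0. \<exists>\<xi>\<in>C. nsmul n q = \<kappa> \<xi> \<and> \<xi> < nsmul n \<gamma>}"

definition Upper :: "'q set"
  where "Upper = {q. \<exists>n>0. \<exists>\<xi>\<in>C. nsmul n q = \<kappa> \<xi> \<and> nsmul n \<gamma> < \<xi>}"

text \<open>Purity excludes the remaining possibility
  \<open>\<xi> = nsmul n \<gamma>\<close>.\<close>

lemma Lower_Upper:
  assumes "\<gamma> \<notin> C"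
  shows "Lower \<union> Upper = UNIV"
proof -
  have "q \<in> Lower \<union> Upper" for q
  proof -
    obtain n \<xi> where n: "n > 0" "\<xi> \<in> C" "nsmul n q = \<kappa> \<xi>" using \<kappa>_multiple by blast
    moreover have "\<xi> \<noteq> nsmul n \<gamma>" using n pure assms by blast
    ultimately show ?thesis
      unfolding Lower_def Upper_def by (metis (mono_tags, lifting) UnI1 UnI2 linorder_neqE mem_Collect_eq)
  qed
  then show ?thesis by blast
qed

lemma Lower_less_Upper:
  assumes "a \<in> Lower" "b \<in> Upper"
  shows "a < b"
proof -
  obtain m \<xi> where a: "m > 0" "\<xi> \<in> C" "nsmul m a = \<kappa> \<xi>" "\<xi> < nsmul m \<gamma>"
    using assms(1) unfolding Lower_def by blast
  obtain n \<eta> where b: "n > 0" "\<eta> \<in> C" "nsmul n b = \<kappa> \<eta>" "nsmul n \<gamma> < \<eta>"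
    using assms(2) unfolding Upper_def by blast
  have "nsmul n \<xi> < nsmul n (nsmul m \<gamma>)" using a b by simp
  also have "\<dots> = nsmul m (nsmul n \<gamma>)" by (rule nsmul_comm)
  also have "\<dots> < nsmul m \<eta>" using a b by simp
  finally have "\<kappa> (nsmul n \<xi>) < \<kappa> (nsmul m \<eta>)"
    using a b by (intro \<kappa>_mono C_closed)
  then have "nsmul (m * n) a < nsmul (m * n) b"
    using a(2,3) b(2,3) by (simp add: \<kappa>_nsmul flip: nsmul_mult) (metis nsmul_comm)
  then show ?thesis using a(1) b(1) by simp
qed

lemma realizes_cut:
  assumes "realizes \<beta> f"
  shows "q \<in> Lower \<Longrightarrow> sme_less (zero_ext (\<Phi> q)) \<beta>" "q \<in> Upper \<Longrightarrow> sme_less \<beta> (zero_ext (\<Phi> q))"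
proof -
  note f = realizesD[OF assms]
  have eq: "nsmul n (zero_ext (\<Phi> q)) = f \<xi>" if "nsmul n q = \<kappa> \<xi>" "\<xi> \<in> C" for n \<xi>
    using that f(4) zero_ext_nsmul[of n q] by (simp add: F_def)
  show "sme_less (zero_ext (\<Phi> q)) \<beta>" if q: "q \<in> Lower"
  proof -
    obtain n \<xi> where "n > 0" "\<xi> \<in> C" "nsmul n q = \<kappa> \<xi>" "\<xi> < nsmul n \<gamma>"
      using q unfolding Lower_def by blast
    then show ?thesis
      using f(2)[of \<xi> "nsmul n \<gamma>"] eq[of n \<xi>] f(3,5) sme_less_affine[of n "zero_ext (\<Phi> q)" 0 \<beta>] by simp
  qed
  show "sme_less \<beta> (zero_ext (\<Phi> q))" if q: "q \<in> Upper"
  proof -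
    obtain n \<xi> where "n > 0" "\<xi> \<in> C" "nsmul n q = \<kappa> \<xi>" "nsmul n \<gamma> < \<xi>"
      using q unfolding Upper_def by blast
    then show ?thesis
      using f(2)[of "nsmul n \<gamma>" \<xi>] eq[of n \<xi>] f(3,5) sme_less_affine[of n \<beta> 0 "zero_ext (\<Phi> q)"] by simp
  qed
qed

text \<open>Outside \<open>C\<close>, a positive element is \<xi> plus or minus a multiple
  \<open>k > 0\<close> of \<gamma>. Positivity then says that \<open>- \<xi>\<close> over
  \<open>k\<close> is in \<open>Lower\<close>, or \<xi> over \<open>k\<close> in
  \<open>Upper\<close>, so filling the cut makes the whole extended map order-preserving.\<close>

lemma realizes_transcendental:
  assumes "\<gamma> \<notin> C"
    and lower: "\<And>q. q \<in> Lower \<Longrightarrow> sme_less (zero_ext (\<Phi> q)) \<beta>"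
    and upper: "\<And>q. q \<in> Upper \<Longrightarrow> sme_less \<beta> (zero_ext (\<Phi> q))"
  obtains f where "realizes \<beta> f"
proof -
  have tf: "nsmul n \<gamma> \<notin> C" if "n > 0" for n
    using pure that assms(1) by blast
  obtain f where f: "\<And>x y. f (x + y) = f x + f y" "f \<gamma> = \<beta>" "\<And>\<xi>. \<xi> \<in> C \<Longrightarrow> f \<xi> = F \<xi>"
    using extend_additive[OF subgroup_C F_add generated tf] by blast
  have f_nsmul: "f (nsmul n x) = nsmul n (f x)" for n x
    using additive_nsmul[of UNIV f x n] f(1) by (auto simp: subgroup_add_grp_iff)
  have f_diff: "f (x - y) = f x - f y" for x y
    using f(1)[of "x - y" y] by (simp add: algebra_simps)
  have pos: "sme_less 0 (f x)" if "0 < x" for x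
  proof -
    obtain \<xi> m n where x: "x = \<xi> + nsmul m \<gamma> - nsmul n \<gamma>" and \<xi>: "\<xi> \<in> C"
      using generate_insert_decomp[OF subgroup_C, of x \<gamma>] generated by blast
    consider "m = n" | k where "k > 0" "m = n + k" | k where "k > 0" "n = m + k"
      by (metis less_imp_add_positive linorder_neqE_nat)
    then show ?thesis
    proof cases
      case 1
      then have "x = \<xi>" using x by simp
      then show ?thesis using F_mono[OF C_closed(1) \<xi>] that F_zero f(3)[OF \<xi>] by simp
    next
      case (2 k)
      then have x: "x = \<xi> + nsmul k \<gamma>" using x by (simp add: nsmul_add_left)
      \<comment> \<open>The division takes place in the hull; \<xi> itself need not be divisible in
        \<open>C\<close>.\<close>
      obtain q where q: "nsmul k q = \<kappa> (- \<xi>)" using divisible[OF 2(1)] by blast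
      have "- \<xi> < nsmul k \<gamma>" using add_strict_left_mono[of 0 x "- \<xi>"] that x by simp
      then have "q \<in> Lower" unfolding Lower_def using q 2(1) C_closed(3)[OF \<xi>] by blast
      then have "sme_less (nsmul k (zero_ext (\<Phi> q)) + F \<xi>) (nsmul k \<beta> + F \<xi>)"
        using lower sme_less_affine[OF 2(1)] by blast
      moreover have "nsmul k (zero_ext (\<Phi> q)) = - F \<xi>"
        using q zero_ext_nsmul[of k q] F_uminus[OF \<xi>] by (simp add: F_def)
      ultimately show ?thesis
        unfolding x by (simp add: f \<xi> f_nsmul add.commute)
    next
      case (3 k)
      then have x: "x = \<xi> - nsmul k \<gamma>" using x by (simp add: nsmul_add_left)
      obtain q where q: "nsmul k q = \<kappa> \<xi>" using divisible[OF 3(1)] by blast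
      have "nsmul k \<gamma> < \<xi>" using that x by simp
      then have "q \<in> Upper" unfolding Upper_def using q 3(1) \<xi> by blast
      then have "sme_less (nsmul k \<beta> + - nsmul k \<beta>) (nsmul k (zero_ext (\<Phi> q)) + - nsmul k \<beta>)"
        using upper sme_less_affine[OF 3(1)] by blast
      moreover have "nsmul k (zero_ext (\<Phi> q)) = F \<xi>"
        using q zero_ext_nsmul[of k q] by (simp add: F_def)
      ultimately show ?thesis
        unfolding x by (simp add: f \<xi> f_nsmul f_diff)
    qed
  qed
  show thesis
    by (rule that, rule realizesI[OF f(1) pos f(2,3)])
qed

lemma realizes_algebraic:
  assumes "\<gamma> \<in> C"
  shows "realizes (F \<gamma>) F"
proof -
  have "subgroup C (add_grp UNIV)" "insert \<gamma> C \<subseteq> C" using subgroup_C assms by auto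
  then have "C = UNIV"
    using group.generate_subgroup_incl[OF group_add_grp_UNIV, of "insert \<gamma> C" C] generated by auto
  then show ?thesis
    using F_add F_mono unfolding realizes_def by auto
qed

text \<open>For \<gamma> in \<open>C\<close> the value is forced to be \<open>F \<gamma>\<close>.
  Otherwise two candidates fill the same cut, while a hull element separating them would belong to
  \<open>Lower\<close> or \<open>Upper\<close> and hence lie on the same side of both.\<close>

lemma ex1_realizes: "\<exists>!\<beta>. \<beta> \<in> Sme \<Phi> \<and> (\<exists>f. realizes \<beta> f)"
proof (cases "\<gamma> \<in> C")
  case True
  have "F \<gamma> \<in> Sme \<Phi>" unfolding Sme_def F_def by blast
  then show ?thesis
    using realizes_algebraic[OF True] True realizesD(3,4) by (metis (no_types))
next
  case False
  obtain S \<beta> where \<beta>: "cut_element S \<beta>" "\<And>q. q \<in> Lower \<Longrightarrow> sme_less (zero_ext (\<Phi> q)) \<beta>"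
    "\<And>q. q \<in> Upper \<Longrightarrow> sme_less \<beta> (zero_ext (\<Phi> q))"
    using fill_cut[OF Lower_Upper[OF False] Lower_less_Upper] by blast
  obtain f where f: "realizes \<beta> f"
    using realizes_transcendental[OF False \<beta>(2,3)] by blast
  have "\<beta> \<in> Sme \<Phi>" using cut_element_mem[OF \<beta>(1)] unfolding Sme_def by blast
  moreover have "\<alpha> = \<beta>" if \<alpha>: "\<alpha> \<in> Sme \<Phi>" "realizes \<alpha> g" for \<alpha> g
  proof (rule ccontr)
    assume ne: "\<alpha> \<noteq> \<beta>"
    \<comment> \<open>A candidate from the hull would, by injectivity, equate a positive multiple of
      \<gamma> with an element of \<open>C\<close>, and purity would put \<gamma> into
      \<open>C\<close>.\<close>
    have "\<alpha> \<noteq> zero_ext (\<Phi> q)" for q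
    proof
      assume eq: "\<alpha> = zero_ext (\<Phi> q)"
      obtain n \<xi> where n: "n > 0" "\<xi> \<in> C" "nsmul n q = \<kappa> \<xi>" using \<kappa>_multiple by blast
      have "g (nsmul n \<gamma>) = g \<xi>"
        using realizesD(3,4,5)[OF \<alpha>(2)] n(2,3) zero_ext_nsmul[of n q] eq by (simp add: F_def)
      then have "nsmul n \<gamma> = \<xi>" by (rule realizes_inj[OF \<alpha>(2)])
      then show False using pure n(1,2) False by blast
    qed
    then have "\<alpha> \<in> zero_ext ` EqRk \<Phi> \<union> IncRk \<Phi>" using \<alpha>(1) unfolding Sme_def by blast
    then obtain R where R: "cut_element R \<alpha>"
      using cut_element_zero_ext cut_element_IncRk by blast
    obtain q where "sme_less \<alpha> (zero_ext (\<Phi> q)) \<and> sme_less (zero_ext (\<Phi> q)) \<beta> \<or>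
        sme_less \<beta> (zero_ext (\<Phi> q)) \<and> sme_less (zero_ext (\<Phi> q)) \<alpha>"
      using separate[OF R \<beta>(1) ne] by blast
    moreover have "q \<in> Lower \<or> q \<in> Upper" using Lower_Upper[OF False] by blast
    ultimately show False
      using realizes_cut[OF \<alpha>(2), of q] \<beta>(2,3)[of q] sme_less_asym by blast
  qed
  ultimately show ?thesis using f by blast
qed

end

section \<open>The commensurable part of the given extension\<close>

lemma com_iff: "\<xi> \<in> com \<iota> \<longleftrightarrow> (\<exists>n g. n \<ge> 1 \<and> nsmul n \<xi> = \<iota> g)"
  unfolding com_def by auto

lemma subgroup_com:
  assumes "\<And>x y. \<iota> (x + y) = \<iota> x + \<iota> y"
  shows "subgroup (com \<iota>) (add_grp UNIV)"
proof -
  have nsmul: "\<iota> (nsmul n x) = nsmul n (\<iota> x)" for n x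
    using additive_nsmul[of UNIV \<iota> x n] assms by (auto simp: subgroup_add_grp_iff)
  have zero: "\<iota> 0 = 0" using assms[of 0 0] by simp
  have uminus: "\<iota> (- x) = - \<iota> x" for x
    using assms[of x "- x"] zero by (simp add: eq_neg_iff_add_eq_0 add.commute)
  show ?thesis
    unfolding subgroup_add_grp_iff
  proof (intro conjI ballI)
    show "0 \<in> com \<iota>"
      unfolding com_iff using zero by (intro exI[of _ 1] exI[of _ 0]) simp
    show "- \<xi> \<in> com \<iota>" if \<xi>: "\<xi> \<in> com \<iota>" for \<xi>
    proof -
      obtain n g where n: "n \<ge> 1" "nsmul n \<xi> = \<iota> g" using \<xi> unfolding com_iff by blast
      then have "nsmul n (- \<xi>) = \<iota> (- g)" by (simp add: nsmul_uminus uminus)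
      with n(1) show ?thesis unfolding com_iff by blast
    qed
    show "\<xi> + \<eta> \<in> com \<iota>" if \<xi>: "\<xi> \<in> com \<iota>" and \<eta>: "\<eta> \<in> com \<iota>" for \<xi> \<eta>
    proof -
      obtain m g where m: "m \<ge> 1" "nsmul m \<xi> = \<iota> g" using \<xi> unfolding com_iff by blast
      obtain n h where n: "n \<ge> 1" "nsmul n \<eta> = \<iota> h" using \<eta> unfolding com_iff by blast
      have "nsmul (m * n) (\<xi> + \<eta>) = nsmul n (nsmul m \<xi>) + nsmul m (nsmul n \<eta>)"
        by (simp add: nsmul_add nsmul_mult mult.commute)
      also have "\<dots> = \<iota> (nsmul n g + nsmul m h)" by (simp add: m n assms nsmul)
      finally have "nsmul (m * n) (\<xi> + \<eta>) = \<iota> (nsmul n g + nsmul m h)" .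
      moreover have "m * n \<ge> 1" using m(1) n(1) by simp
      ultimately show ?thesis unfolding com_iff by blast
    qed
  qed
qed

lemma com_pure:
  assumes "n > 0" "nsmul n \<xi> \<in> com \<iota>"
  shows "\<xi> \<in> com \<iota>"
proof -
  obtain m g where m: "m \<ge> 1" "nsmul (m * n) \<xi> = \<iota> g"
    using assms(2) unfolding com_iff nsmul_mult by blast
  moreover have "m * n \<ge> 1" using m(1) assms(1) by simp
  ultimately show ?thesis unfolding com_iff by blast
qed

lemma image_mem_com: "\<iota> g \<in> com \<iota>"
  unfolding com_iff by (intro exI[of _ 1] exI[of _ g]) simp

text \<open>The canonical embedding enters as an order-preserving homomorphism extending
  \<open>to_dhull\<close>. This determines \<open>\<kappa>\<close>: some positive multiple of every
  commensurable element lies in the image of \<open>\<iota>\<close>, and the hull is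
  torsion-free.\<close>

theorem proposition2p17:
  fixes \<iota> :: "'g::linordered_ab_group_add \<Rightarrow> 'l::linordered_ab_group_add"
    and \<gamma> :: 'l
    and \<kappa> :: "'l \<Rightarrow> 'g dhull"
    and e :: "'g dhull set \<Rightarrow> 'g dhull set \<Rightarrow> real"
    and \<phi> :: "'g dhull \<Rightarrow> 'g dhull set \<Rightarrow> 'g dhull set"
  assumes "quot_embeddings e"
    and "immediate_embedding \<phi>"
    and "small_extension \<iota>"
    and "generate (add_grp UNIV) (insert \<gamma> (com \<iota>)) = UNIV"
    and "\<kappa> \<in> hom (add_grp (com \<iota>)) (add_grp UNIV)"
    and "strict_mono_on (com \<iota>) \<kappa>"
    and "\<And>g. \<kappa> (\<iota> g) = to_dhull g"
  defines "\<Phi> \<equiv> hull_emb e \<phi>"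
  defines "\<Delta> \<equiv> (\<lambda>\<xi>. zero_ext (\<Phi> (\<kappa> \<xi>))) ` com \<iota>"
  shows "\<exists>!\<beta>. \<beta> \<in> Sme \<Phi> \<and>
    (\<exists>f. f \<in> iso (add_grp UNIV) (add_grp (generate (add_grp UNIV) (insert \<beta> \<Delta>))) \<and>
      (\<forall>x y. x < y \<longleftrightarrow> sme_less (f x) (f y)) \<and>
      f \<gamma> = \<beta> \<and>
      (\<forall>\<xi>\<in>com \<iota>. f \<xi> = zero_ext (\<Phi> (\<kappa> \<xi>))))"
proof -
  have \<iota>_add: "\<iota> (x + y) = \<iota> x + \<iota> y" for x y
    using assms(3) unfolding small_extension_def hom_def by auto
  interpret hull_embedding \<Phi>
    unfolding \<Phi>_def by (rule hull_embedding_hull_emb[OF assms(1,2)])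
  interpret monogenic_extension \<Phi> "com \<iota>" \<kappa> \<gamma>
  proof (intro monogenic_extension.intro monogenic_extension_axioms.intro)
    show "hull_embedding \<Phi>" by (rule hull_embedding_axioms)
    show "subgroup (com \<iota>) (add_grp UNIV)" by (rule subgroup_com[OF \<iota>_add])
    show "\<xi> \<in> com \<iota>" if "n > 0" "nsmul n \<xi> \<in> com \<iota>" for n \<xi>
      by (rule com_pure[OF that])
    show "generate (add_grp UNIV) (insert \<gamma> (com \<iota>)) = UNIV" by (rule assms(4))
    show "\<kappa> (\<xi> + \<eta>) = \<kappa> \<xi> + \<kappa> \<eta>" if "\<xi> \<in> com \<iota>" "\<eta> \<in> com \<iota>" for \<xi> \<eta>
      using hom_mult[OF assms(5), of \<xi> \<eta>] that by simp
    show "\<kappa> \<xi> < \<kappa> \<eta>" if "\<xi> \<in> com \<iota>" "\<eta> \<in> com \<iota>" "\<xi> < \<eta>" for \<xi> \<eta>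
      using strict_mono_onD[OF assms(6)] that by blast
    \<comment> \<open>A numerator can already be taken in the image of \<open>\<iota>\<close>, where
      \<open>\<kappa>\<close> is \<open>to_dhull\<close>.\<close>
    show "\<exists>n \<xi>. n > 0 \<and> \<xi> \<in> com \<iota> \<and> nsmul n q = \<kappa> \<xi>" for q
      using ex_nsmul_eq_to_dhull[of q] assms(7) image_mem_com by metis
  qed
  show ?thesis
    using ex1_realizes unfolding iso_iff_realizes[symmetric] F_def \<Delta>_def .
qed

end
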